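(* Let $n\ge 2$, let $W=\mathrm{Sym}(2n+1)$ be the Coxeter group of type $\mathrm{A}_{2n}$ with generators $s_i=(i,i+1)$, $1\le i\le 2n$, and let $X\le W$ be the subgroup, a Coxeter group of type $\mathrm{B}_n$, generated by $T=\{t_1,\dots,t_n\}$ where $t_1=s_ns_{n+1}s_n=s_{n+1}s_ns_{n+1}=(n,n+2)$ and $t_i=s_{n+1-i}s_{n+i}$ for $2\le i\le n$. Let $K=\{(t_it_j)^2\mid |i-j|\ge 2\}$. For $x\in X$, let $\mathcal{T}_X(x)$ be the set of tilings of the polygon $Y(x)$ corresponding to $\Sigma$-consistent reduced words of $x$, where the two sequences of tiles given by the words $s_ns_{n+1}s_n$ and $s_{n+1}s_ns_{n+1}$ for $t_1$ are identified as one hexagonal megatile. Then for every $x\in X$ there is a bijection between $\mathcal{R}_{X,K}(x)$ and $\mathcal{T}_X(x)$.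
   Context: **Reduced words.** For a Coxeter system $(X,T)$ and a set $K$ of defining relations, two reduced words for $x$ over $T$ are $K$-equivalent if one is obtained from the other by a sequence of replacements of consecutive alternating subwords corresponding to relations in $K$ (here, interchanging adjacent letters $t_i,t_j$ with $|i-j|\ge2$). $\mathcal{R}_{X,K}(x)$ is the set of $K$-equivalence classes of reduced words for $x$ over $T$. $(X,T)$ is a Coxeter system of type $\mathrm{B}_n$ with $m(t_1,t_2)=4$, $m(t_i,t_{i+1})=3$ for $2\le i\le n-1$, and all other pairs of distinct generators commuting. **$\Sigma$-consistent words.** $\Sigma=\{\{s_n,s_{n+1}\}\}\cup\{\{s_{n+1-i},s_{n+i}\}\mid 2\le i\le n\}$. A word over $S=\{s_1,\dots,s_{2n}\}$ is $\Sigma$-consistent if it is a concatenation of blocks, each block being a reduced word over $S$ for some $t_i$. Replacing each letter of a reduced word over $T$ by a reduced word over $S$ for the corresponding $t_i$ gives a reduced word in $W$ (Mühlherr). **Polygons and tilings.** Put $N=2n+1$. For $w\in W$, $Y(w)$ is the (possibly degenerate) $2N$-gon with unit sides and top vertex $M$ such that: the first $N$ edges anticlockwise from $M$ are labelled $1,\dots,N$ consecutively and form the left half of a regular $2N$-gon; the $i$-th edge clockwise from $M$ is a translate of the edge labelled $w^{-1}(i)$. The right-hand path is denoted $B(w)$; $B(\mathrm{id})$ is the left-hand path. **Correspondence of words and tilings.** Compose permutations from right to left. A reduced word $w=s_{i_1}\cdots s_{i_\ell}$ gives elements $u_k=s_{i_{\ell-k+1}}\cdots s_{i_\ell}$ ($0\le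 k\le\ell$) and paths $B(u_0)=B(\mathrm{id}),\dots,B(u_\ell)=B(w)$ in $Y(w)$; consecutive paths bound a rhombus, and these rhombi form the tiling of $Y(w)$ corresponding to the word. In a tiling corresponding to a $\Sigma$-consistent word, the three rhombi coming from a block for $t_1$ form a hexagon, which is regarded as a single tile (megatile), so that the two choices of reduced word for that block give the same element of $\mathcal{T}_X(x)$. *)

theory Defs
  imports "HOL-Algebra.Generated_Groups" "HOL-Algebra.Sym_Groups" "HOL-Analysis.Convex"
begin

section \<open>Reduced words\<close>

text \<open>
  A generating set is given as a family \<open>g\<close> over an index set \<open>I\<close>, and a word is the list
  of the indices of its letters.
\<close>

definition word_prod :: "('a, 'b) monoid_scheme \<Rightarrow> ('i \<Rightarrow> 'a) \<Rightarrow> 'i list \<Rightarrow> 'a" where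
  "word_prod G g w = foldr (\<lambda>i y. g i \<otimes>\<^bsub>G\<^esub> y) w \<one>\<^bsub>G\<^esub>"

definition reduced_words ::
    "('a, 'b) monoid_scheme \<Rightarrow> ('i \<Rightarrow> 'a) \<Rightarrow> 'i set \<Rightarrow> 'a \<Rightarrow> 'i list set" where
  "reduced_words G g I x =
     {w \<in> lists I. word_prod G g w = x \<and>
        (\<forall>v \<in> lists I. word_prod G g v = x \<longrightarrow> length w \<le> length v)}"

primrec alternating :: "nat \<Rightarrow> 'i \<Rightarrow> 'i \<Rightarrow> 'i list" where
  "alternating 0 i j = []"
| "alternating (Suc m) i j = i # alternating m j i"

text \<open>
  A triple \<open>(i, j, m)\<close> stands for the defining relation \<open>(g i g j)\<^sup>m = 1\<close>, which is used to
  replace one alternating word of length \<open>m\<close> in the letters \<open>i, j\<close> by the other one.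
\<close>

definition replacement :: "('i \<times> 'i \<times> nat) set \<Rightarrow> ('i list \<times> 'i list) set" where
  "replacement K =
     {(u @ alternating m i j @ v, u @ alternating m j i @ v) | u v i j m.
        (i, j, m) \<in> K \<or> (j, i, m) \<in> K}"

definition K_equiv :: "('i \<times> 'i \<times> nat) set \<Rightarrow> 'i list set \<Rightarrow> ('i list \<times> 'i list) set" where
  "K_equiv K R = {(v, w). v \<in> R \<and> w \<in> R \<and> (v, w) \<in> (replacement K)\<^sup>*}"

definition reduced_classes ::
    "('a, 'b) monoid_scheme \<Rightarrow> ('i \<Rightarrow> 'a) \<Rightarrow> 'i set \<Rightarrow> ('i \<times> 'i \<times> nat) set \<Rightarrow> 'a \<Rightarrow>
      'i list set set" where
  "reduced_classes G g I K x =
     reduced_words G g I x // K_equiv K (reduced_words G g I x)"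


section \<open>The groups \<open>W\<close> and \<open>X\<close>\<close>

text \<open>Multiplication in \<^const>\<open>sym_group\<close> is composition from right to left.\<close>

definition W :: "nat \<Rightarrow> (nat \<Rightarrow> nat) monoid" where
  "W n = sym_group (2 * n + 1)"

definition s :: "nat \<Rightarrow> nat \<Rightarrow> nat" where
  "s i = Transposition.transpose i (i + 1)"

definition t :: "nat \<Rightarrow> nat \<Rightarrow> nat \<Rightarrow> nat" where
  "t n i = (if i = 1 then s n \<circ> s (n + 1) \<circ> s n else s (n + 1 - i) \<circ> s (n + i))"

lemma t_1:
  "t n 1 = s (n + 1) \<circ> s n \<circ> s (n + 1)"
  "t n 1 = Transposition.transpose n (n + 2)"
  by (auto simp: t_def s_def fun_eq_iff Transposition.transpose_def)

definition X :: "nat \<Rightarrow> (nat \<Rightarrow> nat) monoid" where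
  "X n = (W n)\<lparr>carrier := generate (W n) (t n ` {1..n})\<rparr>"

definition K :: "nat \<Rightarrow> (nat \<times> nat \<times> nat) set" where
  "K n = {(i, j, 2) | i j. i \<in> {1..n} \<and> j \<in> {1..n} \<and> \<bar>int i - int j\<bar> \<ge> 2}"

definition R_X_K :: "nat \<Rightarrow> (nat \<Rightarrow> nat) \<Rightarrow> nat list set set" where
  "R_X_K n x = reduced_classes (X n) (t n) {1..n} (K n) x"


section \<open>\<open>\<Sigma>\<close>-consistent words\<close>

abbreviation reduced_words_W :: "nat \<Rightarrow> (nat \<Rightarrow> nat) \<Rightarrow> nat list set" where
  "reduced_words_W n \<equiv> reduced_words (W n) s {1..2 * n}"

definition block_decomposition :: "nat \<Rightarrow> nat list \<Rightarrow> nat list list \<Rightarrow> bool" where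
  "block_decomposition n w bs \<longleftrightarrow>
     w = concat bs \<and> (\<forall>b \<in> set bs. \<exists>i \<in> {1..n}. b \<in> reduced_words_W n (t n i))"

definition Sigma_consistent :: "nat \<Rightarrow> nat list \<Rightarrow> bool" where
  "Sigma_consistent n w \<longleftrightarrow> (\<exists>bs. block_decomposition n w bs)"


section \<open>Paths and tiles\<close>

text \<open>
  The plane is \<^typ>\<open>complex\<close>, with the top vertex \<open>M\<close> of every polygon \<open>Y(w)\<close> at \<open>0\<close>.
  With \<open>N = 2 * n + 1\<close>, \<open>edge n k\<close> is the unit vector, directed away from \<open>M\<close>, along the
  \<open>k\<close>-th edge anticlockwise from the top vertex of a regular \<open>2N\<close>-gon that is placed
  symmetrically about the vertical axis. Consecutive edges turn by \<open>pi / N\<close>, and the first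
  \<open>N\<close> of them add up to a vector pointing straight down.
\<close>

definition edge :: "nat \<Rightarrow> nat \<Rightarrow> complex" where
  "edge n k = cis (pi + (2 * real k - 1) * pi / (2 * real (2 * n + 1)))"

text \<open>
  \<open>B n w j\<close> is the \<open>j\<close>-th vertex (\<open>0 \<le> j \<le> N\<close>) of the path \<open>B(w)\<close>, counted from \<open>M\<close>. The
  polygon \<open>Y(w)\<close> is bounded by the paths \<open>B(id)\<close> on the left and \<open>B(w)\<close> on the right.
\<close>

definition B :: "nat \<Rightarrow> (nat \<Rightarrow> nat) \<Rightarrow> nat \<Rightarrow> complex" where
  "B n w j = (\<Sum>i = 1..j. edge n (inv_into UNIV w i))"

text \<open>
  The paths \<open>B(u)\<close> and \<open>B(s i \<circ> u)\<close> differ exactly in their \<open>i\<close>-th vertices; the following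
  is the rhombus that they bound.
\<close>

definition rhombus :: "nat \<Rightarrow> (nat \<Rightarrow> nat) \<Rightarrow> nat \<Rightarrow> complex set" where
  "rhombus n u i =
     convex hull {B n u (i - 1), B n u i, B n u (i + 1), B n (s i \<circ> u) i}"

text \<open>
  The rhombi between the paths \<open>B(u)\<close> and \<open>B(w u)\<close> that come from a word \<open>w\<close>, whose letters
  act from right to left. For \<open>u = id\<close> they form the tiling of \<open>Y(w)\<close> corresponding to \<open>w\<close>.
\<close>

primrec rhombi :: "nat \<Rightarrow> (nat \<Rightarrow> nat) \<Rightarrow> nat list \<Rightarrow> complex set set" where
  "rhombi n u [] = {}"
| "rhombi n u (i # w) = insert (rhombus n (word_prod (W n) s w \<circ> u) i) (rhombi n u w)"

text \<open>The three rhombi of a block for \<open>t\<^sub>1\<close> are merged into one hexagonal megatile.\<close>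

definition block_tiles :: "nat \<Rightarrow> (nat \<Rightarrow> nat) \<Rightarrow> nat list \<Rightarrow> complex set set" where
  "block_tiles n u b =
     (if b \<in> reduced_words_W n (t n 1) then {\<Union> (rhombi n u b)} else rhombi n u b)"

primrec megatiling :: "nat \<Rightarrow> nat list list \<Rightarrow> complex set set" where
  "megatiling n [] = {}"
| "megatiling n (b # bs) =
     block_tiles n (word_prod (W n) s (concat bs)) b \<union> megatiling n bs"

text \<open>
  A \<open>\<Sigma>\<close>-consistent word has only one block decomposition: its blocks are
  \<open>[n, n + 1, n]\<close>, \<open>[n + 1, n, n + 1]\<close>, \<open>[n + 1 - i, n + i]\<close> and \<open>[n + i, n + 1 - i]\<close>
  for \<open>i \<ge> 2\<close>, and the first letter of a block determines it.
\<close>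

definition T_X :: "nat \<Rightarrow> (nat \<Rightarrow> nat) \<Rightarrow> complex set set set" where
  "T_X n x =
     {megatiling n bs | w bs. w \<in> reduced_words_W n x \<and> Sigma_consistent n w \<and>
        block_decomposition n w bs}"

end

(*
  A reduced word and its tiling can be read off the one-line notation of the inverse permutation:
  the letters of a word swap neighbouring entries. A letter t_i with i >= 2 inverts two pairs that
  are exchanged by the symmetry k -> 2n + 2 - k, and t_1 inverts the three pairs in {a, n + 1,
  2n + 2 - a}. Counting inverted pairs, and inverted families of this kind,
  shows that a word over T is reduced iff each block puts increasing entries into decreasing order,
  which happens iff the corresponding word over S is reduced.

  Commuting letters of T act on disjoint parts of the path and so leave the set of tiles unchanged.
  Conversely, a tile is a zonotope and determines the set of its edge directions. Along a reduced
  word, the distance of the edge labelled c from a fixed line parallel to it never decreases, and it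
  strictly increases whenever c is an edge of the new tile, where its new value is the maximal
  distance over the tile. Words act from right to left. Hence if the tile of the first letter of a
  word v occurs in the tiling of w, then no letter of w to the left of the one that produces it moves
  the edges of that tile; so this letter commutes with those on its left and can be moved to the
  front, and one concludes by induction.
*)

theory Submission
  imports Defs
begin

section \<open>Words\<close>

text \<open>A tiling here is a set of point sets: it remembers neither the order of the tiles nor
  where on a path a tile was added. Whatever is used to compare two words must therefore be
  computable from the points of a tile alone, which is why \<open>labels\<close> and
  \<open>key\<close> are defined for arbitrary sets. For the same reason the induction needs
  \<open>step_tiles_new\<close>: a tile may be cancelled from a union only if the rest of the word
  does not produce it again. The comparison of keys works because all edge directions lie within a
  half turn, in the order of their labels: \<open>side n c (edge n m)\<close> has the sign of m - c,
  so passing a larger label and being passed by a smaller one push an edge the same way. Symmetry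
  reduces every question about t_i to one comparison, of the entries at n + i and n + i + 1. It also
  gives the hexagon of t_1 a simple linear relation: its outer directions add up to a positive
  multiple of the middle one.\<close>

definition perm_prod :: "('i \<Rightarrow> 'a \<Rightarrow> 'a) \<Rightarrow> 'i list \<Rightarrow> 'a \<Rightarrow> 'a" where
  "perm_prod g w = foldr (\<lambda>i y. g i \<circ> y) w id"

lemma perm_prod_simps [simp]:
  "perm_prod g [] = id"
  "perm_prod g (i # w) = g i \<circ> perm_prod g w"
  by (simp_all add: perm_prod_def)

lemma perm_prod_append [simp]: "perm_prod g (v @ w) = perm_prod g v \<circ> perm_prod g w"
  by (induction v) auto

lemma word_prod_W: "word_prod (W n) g w = perm_prod g w"
  by (induction w) (simp_all add: word_prod_def W_def sym_group_def)

lemma word_prod_X: "word_prod (X n) g w = perm_prod g w"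
  by (induction w) (simp_all add: word_prod_def X_def W_def sym_group_def)

lemma s_apply: "s i k = (if k = i then i + 1 else if k = i + 1 then i else k)"
  by (simp add: s_def Transposition.transpose_def)

lemma s_invol [simp]: "s i (s i k) = k" "s i \<circ> s i = id" "s i \<circ> (s i \<circ> u) = u"
  by (auto simp: s_def fun_eq_iff)

lemma permutes_s: "i \<in> {1..2 * n} \<Longrightarrow> s i permutes {1..2 * n + 1}"
  unfolding s_def by (rule permutes_swap_id) auto

lemma permutes_s_comp:
  "u permutes {1..2 * n + 1} \<Longrightarrow> i \<in> {1..2 * n} \<Longrightarrow> s i \<circ> u permutes {1..2 * n + 1}"
  by (rule permutes_compose[OF _ permutes_s])

lemma permutes_perm_prod_s:
  "w \<in> lists {1..2 * n} \<Longrightarrow> perm_prod s w permutes {1..2 * n + 1}"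
  by (induction w) (simp_all add: permutes_id permutes_s_comp del: One_nat_def)

lemma inv_s_comp:
  assumes "bij u"
  shows "inv' (s i \<circ> u) k = inv' u (s i k)"
proof -
  have "bij (s i)" by (simp add: s_def)
  with assms have "bij (s i \<circ> u)" by (rule bij_comp)
  moreover have "(s i \<circ> u) (inv' u (s i k)) = k"
    using assms by (simp add: bij_is_surj surj_f_inv_f)
  ultimately show ?thesis by (metis bij_inv_eq_iff)
qed

section \<open>The hyperoctahedral group, realised by the permutations that commute with k -> 2n + 2
  - k\<close>

definition symmetric_perms :: "nat \<Rightarrow> (nat \<Rightarrow> nat) set" where
  "symmetric_perms n = {u. u permutes {1..2 * n + 1} \<and>
     (\<forall>a \<in> {1..2 * n + 1}. u (2 * n + 2 - a) = 2 * n + 2 - u a)}"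

text \<open>One fixed reduced word per letter, enough for counting and for ascents; the other
  choices are collected in \<open>blocks\<close>.\<close>

definition block :: "nat \<Rightarrow> nat \<Rightarrow> nat list" where
  "block n i = (if i = 1 then [n, n + 1, n] else [n + 1 - i, n + i])"

definition block_word :: "nat \<Rightarrow> nat list \<Rightarrow> nat list" where
  "block_word n v = concat (map (block n) v)"

lemma block_word_simps [simp]:
  "block_word n [] = []"
  "block_word n (i # v) = block n i @ block_word n v"
  "block_word n (v @ v') = block_word n v @ block_word n v'"
  by (simp_all add: block_word_def)

lemma perm_prod_block: "perm_prod s (block n i) = t n i"
  by (simp add: block_def t_def Fun.comp_assoc)

lemma perm_prod_block_word: "perm_prod s (block_word n v) = perm_prod (t n) v"
  by (induction v) (simp_all add: perm_prod_block)

lemma block_in_lists: "i \<in> {1..n} \<Longrightarrow> block n i \<in> lists {1..2 * n}"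
  by (auto simp: block_def)

lemma block_word_in_lists: "v \<in> lists {1..n} \<Longrightarrow> block_word n v \<in> lists {1..2 * n}"
  by (induction v) (use block_in_lists in auto)

lemma t_apply:
  assumes "i \<in> {1..n}"
  shows "t n i k = (if i = 1 then (if k = n then n + 2 else if k = n + 2 then n else k)
     else if k = n + 1 - i then n + 2 - i else if k = n + 2 - i then n + 1 - i
     else if k = n + i then n + i + 1 else if k = n + i + 1 then n + i else k)"
proof (cases "i = 1")
  case True
  then show ?thesis by (simp add: t_def s_apply)
next
  case False
  define j where "j = n + 1 - i"
  then have j: "n + 1 - i = j" "n + 2 - i = j + 1" "j + 1 < n + i"
    using assms False by auto
  have "t n i k = s j (s (n + i) k)"
    using False j by (simp add: t_def)
  with False j(3) show ?thesis unfolding j by (simp add: s_apply)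
qed

lemma t_invol [simp]:
  assumes "i \<in> {1..n}"
  shows "t n i (t n i k) = k" "t n i \<circ> (t n i \<circ> u) = u"
proof -
  show *: "t n i (t n i k) = k" for k
  proof (cases "i = 1")
    case True
    then show ?thesis unfolding t_apply[OF assms] by simp
  next
    case False
    with assms have "n + 1 - i < n + 2 - i" "n + 2 - i < n + i" by auto
    with False show ?thesis unfolding t_apply[OF assms] by simp
  qed
  then show "t n i \<circ> (t n i \<circ> u) = u" by (simp add: fun_eq_iff)
qed

lemma t_permutes: "i \<in> {1..n} \<Longrightarrow> t n i permutes {1..2 * n + 1}"
  using permutes_perm_prod_s[OF block_in_lists] by (simp add: perm_prod_block)

lemma symmetric_permsD:
  assumes "u \<in> symmetric_perms n"
  shows "u permutes {1..2 * n + 1}" "bij u"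
  using assms by (auto simp: symmetric_perms_def permutes_bij)

lemma id_symmetric: "id \<in> symmetric_perms n"
  by (simp add: symmetric_perms_def permutes_id)

lemma s_commute: "i + 1 < j \<Longrightarrow> s j (s i k) = s i (s j k)"
  by (simp add: s_apply)

text \<open>Conjugation by the reflection k -> 2n + 2 - k carries adjacent transpositions to
  adjacent ones. The range of \<open>a\<close> keeps the subtractions from truncating.\<close>

lemma s_reflect:
  assumes "j \<in> {1..2 * n}" "a \<in> {1..2 * n + 1}"
  shows "s j (2 * n + 2 - a) = 2 * n + 2 - s (2 * n + 1 - j) a"
  using assms by (auto simp: s_apply)

lemma t_symmetric:
  assumes "i \<in> {1..n}"
  shows "t n i \<in> symmetric_perms n"
proof -
  have range: "s j a \<in> {1..2 * n + 1}" if "j \<in> {1..2 * n}" "a \<in> {1..2 * n + 1}" for j a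
    using that by (auto simp: s_apply)
  have "t n i (2 * n + 2 - a) = 2 * n + 2 - t n i a" if a: "a \<in> {1..2 * n + 1}" for a
  proof (cases "i = 1")
    case True
    with a show ?thesis unfolding t_apply[OF assms] by auto
  next
    case False
    have "2 * n + 1 - (n + 1 - i) = n + i" "2 * n + 1 - (n + i) = n + 1 - i"
      and mem: "n + 1 - i \<in> {1..2 * n}" "n + i \<in> {1..2 * n}"
      using assms by auto
    \<comment> \<open>Reflection exchanges the two letters, so their product comes out in the
      opposite order and they have to commute.\<close>
    moreover have commute: "s (n + i) (s (n + 1 - i) a) = s (n + 1 - i) (s (n + i) a)"
      using assms False by (intro s_commute) auto
    moreover have "t n i (2 * n + 2 - a) = s (n + 1 - i) (2 * n + 2 - s (2 * n + 1 - (n + i)) a)"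
      using False by (simp only: t_def s_reflect[OF mem(2) a] if_False comp_apply)
    ultimately have "t n i (2 * n + 2 - a) = 2 * n + 2 - s (n + i) (s (n + 1 - i) a)"
      by (simp only: s_reflect[OF mem(1) range[OF mem(1) a]])
    with False commute show ?thesis by (simp add: t_def)
  qed
  with t_permutes[OF assms] show ?thesis by (simp add: symmetric_perms_def)
qed

lemma symmetric_perms_comp:
  assumes "u \<in> symmetric_perms n" "v \<in> symmetric_perms n"
  shows "u \<circ> v \<in> symmetric_perms n"
proof -
  have "v a \<in> {1..2 * n + 1}" if "a \<in> {1..2 * n + 1}" for a
    using assms that by (simp only: symmetric_perms_def mem_Collect_eq permutes_in_image)
  moreover have "u \<circ> v permutes {1..2 * n + 1}"
    using assms by (intro permutes_compose) (simp_all add: symmetric_perms_def)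
  ultimately show ?thesis
    using assms by (simp add: symmetric_perms_def)
qed

lemma perm_prod_t_symmetric: "v \<in> lists {1..n} \<Longrightarrow> perm_prod (t n) v \<in> symmetric_perms n"
  by (induction v) (auto intro!: id_symmetric symmetric_perms_comp t_symmetric)

lemma inv_symmetric:
  assumes "u \<in> symmetric_perms n" "k \<in> {1..2 * n + 1}"
  shows "inv' u (2 * n + 2 - k) = 2 * n + 2 - inv' u k"
proof -
  have u: "u permutes {1..2 * n + 1}"
    using assms symmetric_permsD by auto
  have r: "inv' u k \<in> {1..2 * n + 1}"
    using permutes_in_image[OF permutes_inv[OF u]] assms(2) by simp
  have "u (2 * n + 2 - inv' u k) = 2 * n + 2 - k"
    using assms(1) r by (simp add: symmetric_perms_def permutes_inverses(1)[OF u])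
  then show ?thesis
    by (metis permutes_inverses(2)[OF u])
qed

lemma inv_symmetric_middle:
  assumes "u \<in> symmetric_perms n"
  shows "inv' u (n + 1) = n + 1"
proof -
  have "inv' u (n + 1) \<in> {1..2 * n + 1}"
    using permutes_in_image[OF permutes_inv[OF symmetric_permsD(1)[OF assms]]] by simp
  then show ?thesis
    using inv_symmetric[OF assms, of "n + 1"] by simp
qed

lemma inv_t_comp:
  assumes "bij u" "i \<in> {1..n}"
  shows "inv' (t n i \<circ> u) k = inv' u (t n i k)"
proof -
  have "bij (t n i \<circ> u)"
    using assms(1) permutes_bij[OF t_permutes[OF assms(2)]] by (rule bij_comp)
  moreover have "(t n i \<circ> u) (inv' u (t n i k)) = k"
    using assms by (simp add: bij_is_surj surj_f_inv_f)
  ultimately show ?thesis by (metis bij_inv_eq_iff)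
qed


section \<open>Inversions and ascending words\<close>

definition inversions :: "nat \<Rightarrow> (nat \<Rightarrow> nat) \<Rightarrow> (nat \<times> nat) set" where
  "inversions n u = {(a, b). 1 \<le> a \<and> a < b \<and> b \<le> 2 * n + 1 \<and> u b < u a}"

lemma finite_inversions: "finite (inversions n u)"
  by (rule finite_subset[of _ "{1..2 * n + 1} \<times> {1..2 * n + 1}"]) (auto simp: inversions_def)

text \<open>No value lies strictly between j and j + 1, so swapping these two values changes the
  order of just one pair of arguments.\<close>

lemma card_inversions_s:
  assumes u: "u permutes {1..2 * n + 1}" and j: "j \<in> {1..2 * n}"
    and asc: "inv' u j < inv' u (j + 1)"
  shows "card (inversions n (s j \<circ> u)) = card (inversions n u) + 1"
proof -
  have u_iff: "u c = k \<longleftrightarrow> c = inv' u k" for c k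
    using permutes_inv_eq[OF u] by metis
  have range: "inv' u j \<in> {1..2 * n + 1}" "inv' u (j + 1) \<in> {1..2 * n + 1}"
    using permutes_in_image[OF permutes_inv[OF u]] j by auto
  have "(a, b) \<in> inversions n (s j \<circ> u) \<longleftrightarrow>
      (a, b) \<in> insert (inv' u j, inv' u (j + 1)) (inversions n u)" for a b
  proof -
    have "s j (u b) < s j (u a) \<longleftrightarrow> u b < u a" if "a < b" "(a, b) \<noteq> (inv' u j, inv' u (j + 1))"
    proof -
      have "\<not> (u a = j \<and> u b = j + 1)" "\<not> (u b = j \<and> u a = j + 1)"
        using that asc u_iff[of a] u_iff[of b] by auto
      moreover have "u a \<noteq> u b"
        using that(1) permutes_inj[OF u] by (metis injD less_irrefl)
      ultimately show ?thesis by (auto simp: s_apply)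
    qed
    moreover have "u (inv' u j) = j" "u (inv' u (j + 1)) = j + 1"
      using permutes_inverses(1)[OF u] by auto
    ultimately show ?thesis
      using range asc
      by (cases "(a, b) = (inv' u j, inv' u (j + 1))"; cases "a < b")
         (simp_all add: inversions_def s_apply, auto)
  qed
  then have "inversions n (s j \<circ> u) = insert (inv' u j, inv' u (j + 1)) (inversions n u)"
    by auto
  moreover have "(inv' u j, inv' u (j + 1)) \<notin> inversions n u"
    using permutes_inverses(1)[OF u] by (auto simp: inversions_def)
  ultimately show ?thesis by (simp add: finite_inversions)
qed

lemma card_inversions_s_le:
  assumes u: "u permutes {1..2 * n + 1}" and j: "j \<in> {1..2 * n}"
  shows "card (inversions n (s j \<circ> u)) \<le> card (inversions n u) + 1"
proof (cases "inv' u j < inv' u (j + 1)")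
  case True
  then show ?thesis using card_inversions_s[OF assms] by simp
next
  case False
  have "inv' u j \<noteq> inv' u (j + 1)"
    using permutes_inverses(1)[OF u] by (metis Suc_eq_plus1 n_not_Suc_n)
  with False have "inv' (s j \<circ> u) j < inv' (s j \<circ> u) (j + 1)"
    by (simp add: inv_s_comp[OF permutes_bij[OF u]] s_apply)
  \<comment> \<open>An ascent leads from \<open>s j \<circ> u\<close> back to \<open>u\<close>, so
    here the number drops by one.\<close>
  from card_inversions_s[OF permutes_s_comp[OF u j] j this] show ?thesis by simp
qed

lemma card_inversions_le_length:
  "w \<in> lists {1..2 * n} \<Longrightarrow> card (inversions n (perm_prod s w)) \<le> length w"
proof (induction w)
  case Nil
  have "inversions n id = {}" by (auto simp: inversions_def)
  then show ?case by (simp only: perm_prod_simps card.empty)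
next
  case (Cons j w)
  have "card (inversions n (s j \<circ> perm_prod s w)) \<le> card (inversions n (perm_prod s w)) + 1"
    using Cons.prems by (intro card_inversions_s_le permutes_perm_prod_s) auto
  also have "\<dots> \<le> length (j # w)" using Cons by simp
  finally show ?case by (simp only: perm_prod_simps)
qed

text \<open>Read from the right, each letter has to create an inversion. The starting permutation
  \<open>u\<close> is a parameter so that a word can be cut anywhere, as in
  \<open>ascending_append\<close>.\<close>

primrec ascending :: "(nat \<Rightarrow> nat) \<Rightarrow> nat list \<Rightarrow> bool" where
  "ascending u [] = True"
| "ascending u (j # w) = (ascending u w \<and>
     inv' (perm_prod s w \<circ> u) j < inv' (perm_prod s w \<circ> u) (j + 1))"

lemma ascending_append:
  "ascending u (v @ w) \<longleftrightarrow> ascending u w \<and> ascending (perm_prod s w \<circ> u) v"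
  by (induction v) (auto simp only: append.simps ascending.simps perm_prod_append perm_prod_simps
      Fun.comp_assoc id_comp)

lemma card_inversions_ascending:
  assumes "u permutes {1..2 * n + 1}" "w \<in> lists {1..2 * n}" "ascending u w"
  shows "card (inversions n (perm_prod s w \<circ> u)) = card (inversions n u) + length w"
  using assms(2,3)
proof (induction w rule: list.induct)
  case (Cons j w)
  then have mem: "j \<in> {1..2 * n}" "w \<in> lists {1..2 * n}" "ascending u w" by auto
  from Cons have "perm_prod s w \<circ> u permutes {1..2 * n + 1}"
    by (intro permutes_compose[OF assms(1)] permutes_perm_prod_s) auto
  then have "card (inversions n (s j \<circ> (perm_prod s w \<circ> u))) =
      card (inversions n (perm_prod s w \<circ> u)) + 1"
    using card_inversions_s Cons.prems(2) mem by simp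
  also have "\<dots> = card (inversions n u) + length (j # w)"
    unfolding Cons.IH[OF mem(2,3)] by simp
  finally show ?case by (simp only: perm_prod_simps Fun.comp_assoc)
qed simp

text \<open>For i \<ge> 2 the entries at n + 1 - i, n + 2 - i mirror those at n + i, n + i + 1. For
  i = 1 the three entries are 2n + 2 - b, n + 1, b, so n + 1 < b decides all three swaps.\<close>

lemma ascending_block:
  assumes u: "u \<in> symmetric_perms n" and i: "i \<in> {1..n}"
  shows "ascending u (block n i) \<longleftrightarrow> inv' u (n + i) < inv' u (n + i + 1)"
proof -
  have range: "inv' u k \<in> {1..2 * n + 1}" if "k \<in> {1..2 * n + 1}" for k
    using permutes_in_image[OF permutes_inv[OF symmetric_permsD(1)[OF u]]] that by simp
  have inv_s: "inv' (s j \<circ> v) k = inv' v (s j k)" if "bij v" for j k v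
    using that by (rule inv_s_comp)
  have bij: "bij u" "bij (s j \<circ> u)" "bij (s k \<circ> (s j \<circ> u))" for j k
    using symmetric_permsD(2)[OF u] by (auto intro!: bij_comp simp: s_def)
  show ?thesis
  proof (cases "i = 1")
    case True
    have "inv' u n = 2 * n + 2 - inv' u (n + 2)"
      using inv_symmetric[OF u, of "n + 2"] i by simp
    with True show ?thesis
      using range[of "n + 2"] i inv_symmetric_middle[OF u]
      by (auto simp: block_def inv_s bij s_apply Fun.comp_assoc)
  next
    case False
    have "inv' u (n + 1 - i) = 2 * n + 2 - inv' u (n + i + 1)"
      "inv' u (n + 2 - i) = 2 * n + 2 - inv' u (n + i)"
      using inv_symmetric[OF u, of "n + i + 1"] inv_symmetric[OF u, of "n + i"] i
      by (simp_all add: algebra_simps)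
    moreover have "Suc n - i + 1 = n + 2 - i" using i by auto
    moreover have "Suc (Suc n - i) = n + 2 - i" using i by auto
    ultimately show ?thesis
      using range[of "n + i"] range[of "n + i + 1"] False i
        diff_less_mono2[of "inv' u (n + i)" "inv' u (n + i + 1)" "2 * n + 2"]
      by (auto simp: block_def inv_s bij s_apply)
  qed
qed

section \<open>Length in type B\<close>

lemma t_one_apply: "t n 1 k = (if k = n then n + 2 else if k = n + 2 then n else k)"
  by (simp add: t_def s_apply)

text \<open>With n + 1 as origin a symmetric \<open>u\<close> is a signed permutation, and this is
  the set of positive positions that it makes negative; along a reduced word its size counts the
  letters t_1.\<close>

definition negatives :: "nat \<Rightarrow> (nat \<Rightarrow> nat) \<Rightarrow> nat set" where
  "negatives n u = {b. n + 2 \<le> b \<and> b \<le> 2 * n + 1 \<and> u b < n + 1}"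

text \<open>
  Twice the length in \<open>X\<close>: an ascent along \<open>t\<^sub>i\<close> creates two inversions if \<open>i \<ge> 2\<close>, and three
  inversions together with one negative if \<open>i = 1\<close>.
\<close>

definition orbit_weight :: "nat \<Rightarrow> (nat \<Rightarrow> nat) \<Rightarrow> int" where
  "orbit_weight n u = int (card (inversions n u)) - int (card (negatives n u))"

lemma finite_negatives: "finite (negatives n u)"
  by (rule finite_subset[of _ "{..2 * n + 1}"]) (auto simp: negatives_def)

text \<open>For i \<ge> 2 the letter moves no value across n + 1. For i = 1 it sends the value n + 2
  to n, and the ascent places the argument with value n + 2 in the upper half, where it is
  counted.\<close>

lemma card_negatives_t:
  assumes u: "u \<in> symmetric_perms n" and i: "i \<in> {1..n}"
    and asc: "inv' u (n + i) < inv' u (n + i + 1)"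
  shows "card (negatives n (t n i \<circ> u)) = card (negatives n u) + (if i = 1 then 1 else 0)"
proof (cases "i = 1")
  case False
  then have "t n i k < n + 1 \<longleftrightarrow> k < n + 1" for k
    unfolding t_apply[OF i] using i by auto
  then have "negatives n (t n i \<circ> u) = negatives n u"
    by (simp add: negatives_def)
  with False show ?thesis by simp
next
  case True
  note perm = symmetric_permsD(1)[OF u]
  have range: "inv' u (n + 2) \<in> {1..2 * n + 1}" "inv' u n \<in> {1..2 * n + 1}"
    using permutes_in_image[OF permutes_inv[OF perm]] i True by auto
  have middle: "inv' u n = 2 * n + 2 - inv' u (n + 2)"
    using inv_symmetric[OF u, of "n + 2"] i True by simp
  have above: "inv' u (n + 2) \<ge> n + 2"
    using asc True inv_symmetric_middle[OF u] by simp
  have "b \<in> negatives n (t n i \<circ> u) \<longleftrightarrow> b \<in> insert (inv' u (n + 2)) (negatives n u)" for b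
  proof -
    have u_iff: "u b = n \<longleftrightarrow> b = inv' u n" "u b = n + 2 \<longleftrightarrow> b = inv' u (n + 2)"
      using permutes_inv_eq[OF perm, of n b] permutes_inv_eq[OF perm, of "n + 2" b] by auto
    consider "u b = n" | "u b = n + 2" | "u b \<noteq> n" "u b \<noteq> n + 2" by blast
    then show ?thesis
    proof cases
      case 1
      moreover have "t n i n = n + 2" unfolding True t_one_apply by simp
      ultimately show ?thesis
        using u_iff above middle range by (auto simp: negatives_def)
    next
      case 2
      then have "t n i (u b) = n" unfolding True t_one_apply by simp
      with 2 u_iff above range show ?thesis by (simp add: negatives_def)
    next
      case 3
      then have "t n i (u b) = u b" unfolding True t_one_apply by simp
      with 3 u_iff show ?thesis by (simp add: negatives_def)
    qed
  qed
  then have "negatives n (t n i \<circ> u) = insert (inv' u (n + 2)) (negatives n u)"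
    by blast
  moreover have "inv' u (n + 2) \<notin> negatives n u"
    using permutes_inverses(1)[OF perm] by (simp add: negatives_def)
  ultimately show ?thesis
    using True by (simp add: finite_negatives)
qed

lemma ascent_step:
  assumes u: "u \<in> symmetric_perms n" and i: "i \<in> {1..n}"
    and asc: "inv' u (n + i) < inv' u (n + i + 1)"
  shows "card (inversions n (t n i \<circ> u)) = card (inversions n u) + length (block n i)"
    and "orbit_weight n (t n i \<circ> u) = orbit_weight n u + 2"
proof -
  show *: "card (inversions n (t n i \<circ> u)) = card (inversions n u) + length (block n i)"
    using card_inversions_ascending[OF symmetric_permsD(1)[OF u] block_in_lists[OF i]]
      ascending_block[OF u i] asc by (simp add: perm_prod_block)
  have "length (block n i) = 2 + (if i = 1 then 1 else 0)"
    by (simp add: block_def)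
  then show "orbit_weight n (t n i \<circ> u) = orbit_weight n u + 2"
    unfolding orbit_weight_def * card_negatives_t[OF assms] by simp
qed

lemma descent_reversed:
  assumes u: "u \<in> symmetric_perms n" and i: "i \<in> {1..n}"
    and desc: "\<not> inv' u (n + i) < inv' u (n + i + 1)"
  shows "inv' (t n i \<circ> u) (n + i) < inv' (t n i \<circ> u) (n + i + 1)"
proof -
  note perm = symmetric_permsD(1)[OF u]
  have ne: "inv' u (n + i) \<noteq> inv' u (n + i + 1)"
    using permutes_inverses(1)[OF perm] by (metis Suc_eq_plus1 n_not_Suc_n)
  show ?thesis
  proof (cases "i = 1")
    case True
    have "inv' u n = 2 * n + 2 - inv' u (n + 2)"
      using inv_symmetric[OF u, of "n + 2"] i True by simp
    moreover have "t n i (n + 1) = n + 1" "t n i (n + 2) = n"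
      unfolding t_apply[OF i] using True by simp_all
    ultimately show ?thesis
      using True desc ne inv_symmetric_middle[OF u]
      unfolding inv_t_comp[OF symmetric_permsD(2)[OF u] i] by simp
  next
    case False
    then have "t n i (n + i) = n + i + 1" "t n i (n + i + 1) = n + i"
      unfolding t_apply[OF i] using i by auto
    with desc ne show ?thesis
      unfolding inv_t_comp[OF symmetric_permsD(2)[OF u] i] by simp
  qed
qed

lemma descent_step:
  assumes u: "u \<in> symmetric_perms n" and i: "i \<in> {1..n}"
    and desc: "\<not> inv' u (n + i) < inv' u (n + i + 1)"
  shows "card (inversions n (t n i \<circ> u)) < card (inversions n u)"
    and "orbit_weight n (t n i \<circ> u) = orbit_weight n u - 2"
proof -
  have "length (block n i) > 0" by (simp add: block_def)
  then show "card (inversions n (t n i \<circ> u)) < card (inversions n u)"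
    and "orbit_weight n (t n i \<circ> u) = orbit_weight n u - 2"
    using ascent_step[OF symmetric_perms_comp[OF t_symmetric[OF i] u] i descent_reversed[OF assms]]
    unfolding t_invol(2)[OF i] by simp_all
qed

definition ascending_blocks :: "nat \<Rightarrow> nat list \<Rightarrow> bool" where
  "ascending_blocks n v \<longleftrightarrow> ascending id (block_word n v)"

lemma ascending_blocks_Nil [simp]: "ascending_blocks n []"
  by (simp add: ascending_blocks_def)

lemma ascending_block_word_Cons:
  assumes "i \<in> {1..n}" "v \<in> lists {1..n}"
  shows "ascending_blocks n (i # v) \<longleftrightarrow> ascending_blocks n v \<and>
    inv' (perm_prod (t n) v) (n + i) < inv' (perm_prod (t n) v) (n + i + 1)"
  using ascending_block[OF perm_prod_t_symmetric[OF assms(2)] assms(1)]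
  by (simp only: ascending_blocks_def block_word_simps ascending_append comp_id perm_prod_block_word)

text \<open>Two bounds run in parallel: letters over S bound the inversions, twice the letters over
  T bound the weight. An ascent adds equally to both sides, a descent lengthens the word while the
  measures drop, and a deficit once created never disappears. Hence both bounds are attained by the
  same words.\<close>

lemma block_word_measures:
  assumes "v \<in> lists {1..n}"
  shows "(ascending_blocks n v \<longrightarrow>
      card (inversions n (perm_prod (t n) v)) = length (block_word n v) \<and>
      orbit_weight n (perm_prod (t n) v) = 2 * int (length v)) \<and>
    (\<not> ascending_blocks n v \<longrightarrow>
      card (inversions n (perm_prod (t n) v)) < length (block_word n v) \<and>
      orbit_weight n (perm_prod (t n) v) < 2 * int (length v))"
  using assms
proof (induction v rule: list.induct)
  case Nil
  have "inversions n id = {}" "negatives n id = {}"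
    by (auto simp: inversions_def negatives_def)
  then show ?case by (simp only: perm_prod_simps orbit_weight_def) simp
next
  case (Cons i v)
  then have iv: "i \<in> {1..n}" "v \<in> lists {1..n}" by auto
  note IH = Cons.IH[OF iv(2)]
  let ?u = "perm_prod (t n) v"
  note steps = ascent_step[OF perm_prod_t_symmetric[OF iv(2)] iv(1)]
    descent_step[OF perm_prod_t_symmetric[OF iv(2)] iv(1)]
  have len: "length (block_word n (i # v)) = length (block n i) + length (block_word n v)"
    "length (i # v) = length v + 1" by simp_all
  show ?case
  proof (cases "inv' ?u (n + i) < inv' ?u (n + i + 1)")
    case True
    then show ?thesis
      unfolding ascending_block_word_Cons[OF iv] perm_prod_simps steps(1)[OF True]
        steps(2)[OF True] len using IH by auto
  next
    case False
    then show ?thesis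
      unfolding ascending_block_word_Cons[OF iv] perm_prod_simps steps(4)[OF False] len
      using IH steps(3)[OF False] by (auto simp: comp_def)
  qed
qed

text \<open>The entries at n + 1, ..., 2n + 1 increase from n + 1 and do not exceed 2n + 1, so they
  are squeezed to the identity; the lower half follows by reflection.\<close>

lemma no_descent_imp_id:
  assumes u: "u \<in> symmetric_perms n"
    and asc: "\<And>i. i \<in> {1..n} \<Longrightarrow> inv' u (n + i) < inv' u (n + i + 1)"
  shows "u = id"
proof -
  note perm = symmetric_permsD(1)[OF u]
  have range: "inv' u k \<in> {1..2 * n + 1}" if "k \<in> {1..2 * n + 1}" for k
    using permutes_in_image[OF permutes_inv[OF perm]] that by simp
  have lower: "i \<le> n \<Longrightarrow> n + 1 + i \<le> inv' u (n + 1 + i)" for i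
  proof (induction i)
    case (Suc i)
    then show ?case using asc[of "Suc i"] by simp
  qed (use inv_symmetric_middle[OF u] in simp)
  have upper: "i \<le> n \<Longrightarrow> inv' u (2 * n + 1 - i) \<le> 2 * n + 1 - i" for i
  proof (induction i)
    case 0
    then show ?case using range[of "2 * n + 1"] by simp
  next
    case (Suc i)
    have "n + (n - i) = 2 * n + 1 - Suc i" "n + (n - i) + 1 = 2 * n + 1 - i"
      using Suc.prems by auto
    moreover have "n - i \<in> {1..n}" using Suc.prems by auto
    ultimately show ?case using asc[of "n - i"] Suc by simp
  qed
  have up: "inv' u k = k" if "n + 1 \<le> k" "k \<le> 2 * n + 1" for k
  proof -
    have "k - (n + 1) \<le> n" "2 * n + 1 - k \<le> n" using that by auto
    from lower[OF this(1)] upper[OF this(2)] that show ?thesis by simp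
  qed
  have "inv' u k = k" if k: "k \<in> {1..2 * n + 1}" for k
  proof (cases "n + 1 \<le> k")
    case False
    with k have "inv' u (2 * n + 2 - (2 * n + 2 - k)) = 2 * n + 2 - inv' u (2 * n + 2 - k)"
      by (intro inv_symmetric[OF u]) auto
    with False k up[of "2 * n + 2 - k"] show ?thesis by simp
  next
    case True
    with k show ?thesis by (intro up) auto
  qed
  moreover have "inv' u k = k" if "k \<notin> {1..2 * n + 1}" for k
    using permutes_not_in[OF permutes_inv[OF perm] that] .
  ultimately show ?thesis
    using permutes_inverses(1)[OF perm] by (metis eq_id_iff)
qed

text \<open>Sorting: undoing descents lowers the number of inversions until only the identity is
  left. This supplies the words that attain the bounds of
  \<open>block_word_measures\<close>.\<close>

lemma exists_ascending_word:
  "u \<in> symmetric_perms n \<Longrightarrow>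
    \<exists>v \<in> lists {1..n}. perm_prod (t n) v = u \<and> ascending_blocks n v"
proof (induction "card (inversions n u)" arbitrary: u rule: less_induct)
  case less
  show ?case
  proof (cases "\<exists>i \<in> {1..n}. \<not> inv' u (n + i) < inv' u (n + i + 1)")
    case True
    then obtain i where i: "i \<in> {1..n}" "\<not> inv' u (n + i) < inv' u (n + i + 1)" by blast
    have "t n i \<circ> u \<in> symmetric_perms n"
      using symmetric_perms_comp[OF t_symmetric[OF i(1)] less.prems] .
    from less.hyps[OF descent_step(1)[OF less.prems i] this]
    obtain v where v: "v \<in> lists {1..n}" "perm_prod (t n) v = t n i \<circ> u"
      "ascending_blocks n v" by blast
    have "ascending_blocks n (i # v)"
      using ascending_block_word_Cons[OF i(1) v(1)] v(2,3) descent_reversed[OF less.prems i]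
      by simp
    moreover have "perm_prod (t n) (i # v) = u"
      unfolding perm_prod_simps v(2) using i(1) by (rule t_invol)
    ultimately show ?thesis
      using i(1) v(1) by (intro bexI[of _ "i # v"]) auto
  next
    case False
    then have "u = id" using no_descent_imp_id[OF less.prems] by blast
    then show ?thesis by (intro bexI[of _ "[]"]) auto
  qed
qed

text \<open>A word is compared with an ascending word for the same element, whose length is half the
  weight.\<close>

lemma reduced_words_X_iff:
  "v \<in> reduced_words (X n) (t n) {1..n} x \<longleftrightarrow>
    v \<in> lists {1..n} \<and> perm_prod (t n) v = x \<and> ascending_blocks n v"
    (is "?L \<longleftrightarrow> ?R")
proof
  assume L: ?L
  then have v: "v \<in> lists {1..n}" "perm_prod (t n) v = x"
    "\<And>v'. v' \<in> lists {1..n} \<Longrightarrow> perm_prod (t n) v' = x \<Longrightarrow> length v \<le> length v'"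
    by (auto simp: reduced_words_def word_prod_X)
  obtain v' where v': "v' \<in> lists {1..n}" "perm_prod (t n) v' = x"
    "ascending_blocks n v'"
    using exists_ascending_word[OF perm_prod_t_symmetric[OF v(1)]] v(2) by blast
  have "\<not> orbit_weight n x < 2 * int (length v)"
    using block_word_measures[OF v'(1)] v' v(3)[OF v'(1,2)] by auto
  with v show ?R using block_word_measures[OF v(1)] by blast
next
  assume R: ?R
  have "length v \<le> length v'" if "v' \<in> lists {1..n}" "perm_prod (t n) v' = x" for v'
  proof -
    have "orbit_weight n x \<le> 2 * int (length v')"
      using block_word_measures[OF that(1)] that(2) by force
    moreover have "orbit_weight n x = 2 * int (length v)"
      using block_word_measures[of v n] R by auto
    ultimately show ?thesis by simp
  qed
  with R show ?L by (simp add: reduced_words_def word_prod_X)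
qed

text \<open>Inversions bound the length from below for all words; that the bound is attained is
  needed only for products of letters of T, where an ascending block word attains it.\<close>

lemma reduced_words_W_iff:
  assumes "w \<in> lists {1..2 * n}" "v \<in> lists {1..n}" "perm_prod s w = perm_prod (t n) v"
  shows "w \<in> reduced_words_W n (perm_prod (t n) v) \<longleftrightarrow>
    length w = card (inversions n (perm_prod (t n) v))"
proof -
  let ?x = "perm_prod (t n) v"
  obtain v' where v': "v' \<in> lists {1..n}" "perm_prod (t n) v' = ?x"
    "ascending_blocks n v'"
    using exists_ascending_word[OF perm_prod_t_symmetric[OF assms(2)]] by blast
  then have "length (block_word n v') = card (inversions n ?x)"
    using block_word_measures[OF v'(1)] by simp
  moreover have "block_word n v' \<in> lists {1..2 * n}" "perm_prod s (block_word n v') = ?x"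
    using block_word_in_lists[OF v'(1)] v'(2) by (simp_all add: perm_prod_block_word)
  moreover have "card (inversions n ?x) \<le> length w'"
    if "w' \<in> lists {1..2 * n}" "perm_prod s w' = ?x" for w'
    using card_inversions_le_length[OF that(1)] that(2) by simp
  ultimately show ?thesis
    using assms unfolding reduced_words_def word_prod_W mem_Collect_eq by (metis le_antisym)
qed

text \<open>Only length and product of \<open>w\<close> enter, so any choice of reduced words inside
  the blocks is covered.\<close>

lemma reduced_words_W_block_word_iff:
  assumes "w \<in> lists {1..2 * n}" "v \<in> lists {1..n}" "perm_prod s w = perm_prod (t n) v"
    and "length w = length (block_word n v)"
  shows "w \<in> reduced_words_W n (perm_prod (t n) v) \<longleftrightarrow> ascending_blocks n v"
  using reduced_words_W_iff[OF assms(1-3)] block_word_measures[OF assms(2)] assms(4)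
  by (metis less_irrefl)

section \<open>Reduced words over S for the letters of T\<close>

definition blocks :: "nat \<Rightarrow> nat \<Rightarrow> nat list set" where
  "blocks n i = (if i = 1 then {[n, n + 1, n], [n + 1, n, n + 1]}
     else {[n + 1 - i, n + i], [n + i, n + 1 - i]})"

lemma s_eqD: "s p k = m \<Longrightarrow> k = s p m"
  by auto

lemma s_le: "p \<noteq> k \<Longrightarrow> s p k \<le> k" "s p k \<le> k + 1"
  by (simp_all add: s_apply)

text \<open>A letter raises a value by at most one, and raises m only if it is the letter m; this
  drives the two classifications below.\<close>

lemma s_eq_SucD: "s p k = m + 1 \<Longrightarrow> k \<le> m \<Longrightarrow> k = m \<and> p = m"
  by (simp add: s_apply split: if_splits)

text \<open>In three letters n has to climb to n + 2, for which n and n + 1 must act in this order,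
  leaving one letter free; bringing n + 1 back to itself determines what that letter is and where it
  stands.\<close>

lemma words_for_middle_transposition:
  assumes "s p (s q (s r n)) = n + 2" "s p (s q (s r (n + 1))) = n + 1"
  shows "[p, q, r] = [n, n + 1, n] \<or> [p, q, r] = [n + 1, n, n + 1]"
proof (cases "r = n")
  case True
  then have *: "s p (s q (n + 1)) = n + 2" "s p (s q n) = n + 1"
    using assms by (simp_all add: s_apply)
  show ?thesis
  proof (cases "q = n + 1")
    case True
    with *(2) have "s p n = n + 1" by (simp add: s_apply)
    with True \<open>r = n\<close> show ?thesis using s_eq_SucD[of p n n] by simp
  next
    case False
    with *(1) have "p = n + 1" using s_eq_SucD[of p "s q (n + 1)" "n + 1"] s_le(1) by simp
    with *(2) have "s q n = n + 2" using s_eqD[of p "s q n"] by (simp add: s_apply)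
    then show ?thesis using s_le(2)[of q n] by simp
  qed
next
  case False
  then have le: "s r n \<le> n" by (simp add: s_le)
  then have "s q (s r n) \<le> n + 1" using s_le(2)[of q "s r n"] by simp
  with assms(1) have p: "s q (s r n) = n + 1" "p = n + 1"
    using s_eq_SucD[of p "s q (s r n)" "n + 1"] by auto
  with le have q: "q = n" using s_eq_SucD[of q "s r n" n] by simp
  have "s q (s r (n + 1)) = n + 2"
    using s_eqD[OF assms(2)] p(2) by (simp add: s_apply)
  then have "s r (n + 1) = n + 2"
    using s_eqD[of q "s r (n + 1)"] q by (simp add: s_apply)
  with p q show ?thesis using s_eq_SucD[of r "n + 1" "n + 1"] by simp
qed

text \<open>Both a and b have to rise by one, and one letter cannot serve both.\<close>

lemma words_for_distant_transpositions:
  assumes "s p \<circ> s q = s a \<circ> s b" "a + 1 < b"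
  shows "[p, q] = [a, b] \<or> [p, q] = [b, a]"
proof -
  have *: "s p (s q a) = a + 1" "s p (s q b) = b + 1"
    using fun_cong[OF assms(1), of a] fun_cong[OF assms(1), of b] assms(2)
    by (simp_all add: s_apply)
  show ?thesis
  proof (cases "q = a")
    case True
    with *(2) assms(2) have "s p b = b + 1" by (simp add: s_apply)
    with True show ?thesis using s_eq_SucD[of p b b] by simp
  next
    case False
    with *(1) have "p = a" using s_eq_SucD[of p "s q a" a] s_le(1) by simp
    moreover have "s q b = b + 1"
      using s_eqD[OF *(2)] assms(2) calculation by (simp add: s_apply)
    ultimately show ?thesis using s_eq_SucD[of q b b] by simp
  qed
qed

lemma blocks_perm_prod:
  assumes "i \<in> {1..n}" "b \<in> blocks n i"
  shows "perm_prod s b = t n i" "b \<in> lists {1..2 * n}" "length b = length (block n i)"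
proof -
  have "s k \<circ> s j = s j \<circ> s k" if "j + 1 < k" for j k
    using that by (simp add: s_commute fun_eq_iff)
  moreover have "i \<noteq> 1 \<Longrightarrow> n + 1 - i + 1 < n + i"
    using assms(1) by auto
  ultimately have "i \<noteq> 1 \<Longrightarrow> s (n + i) \<circ> s (n + 1 - i) = s (n + 1 - i) \<circ> s (n + i)"
    by blast
  then show "perm_prod s b = t n i"
    using assms(2) t_1(1)[of n] by (auto simp: blocks_def t_def Fun.comp_assoc split: if_splits)
  show "b \<in> lists {1..2 * n}" "length b = length (block n i)"
    using assms by (auto simp: blocks_def block_def split: if_splits)
qed

text \<open>The count of inversions fixes the length, so only words of length two or three remain to
  be classified.\<close>

lemma reduced_words_W_t:
  assumes i: "i \<in> {1..n}"
  shows "reduced_words_W n (t n i) = blocks n i"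
proof -
  have v: "[i] \<in> lists {1..n}" "perm_prod (t n) [i] = t n i" "block_word n [i] = block n i"
    using i by auto
  have "inv' id = (id :: nat \<Rightarrow> nat)" by (simp add: inv_id)
  then have asc: "ascending_blocks n [i]"
    using ascending_block[OF id_symmetric i] by (simp add: ascending_blocks_def)
  show ?thesis
  proof (intro equalityI subsetI)
    fix b assume b: "b \<in> reduced_words_W n (t n i)"
    then have prod: "b \<in> lists {1..2 * n}" "perm_prod s b = t n i"
      by (auto simp: reduced_words_def word_prod_W)
    then have len: "length b = length (block n i)"
      using reduced_words_W_iff[OF prod(1) v(1)] block_word_measures[OF v(1)] asc b
      unfolding v by simp
    show "b \<in> blocks n i"
    proof (cases "i = 1")
      case True
      with len obtain p q r where "b = [p, q, r]"
        by (auto simp: block_def length_Suc_conv)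
      moreover have "s p (s q (s r k)) = t n 1 k" for k
        using True prod(2) \<open>b = [p, q, r]\<close> by (metis comp_apply comp_id perm_prod_simps)
      ultimately have "b = [n, n + 1, n] \<or> b = [n + 1, n, n + 1]"
        using words_for_middle_transposition[of p q r n] unfolding t_one_apply by simp
      then show ?thesis unfolding blocks_def using True by simp
    next
      case False
      with len obtain p q where "b = [p, q]"
        by (auto simp: block_def length_Suc_conv)
      moreover from this have "s p \<circ> s q = s (n + 1 - i) \<circ> s (n + i)"
        using False prod(2) by (simp add: t_def)
      moreover have "n + 1 - i + 1 < n + i" using i False by auto
      ultimately have "b = [n + 1 - i, n + i] \<or> b = [n + i, n + 1 - i]"
        using words_for_distant_transpositions[of p q "n + 1 - i" "n + i"] by blast
      then show ?thesis unfolding blocks_def using False by simp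
    qed
  next
    fix b assume "b \<in> blocks n i"
    from blocks_perm_prod[OF i this] show "b \<in> reduced_words_W n (t n i)"
      using reduced_words_W_block_word_iff[of b n "[i]"] v asc by simp
  qed
qed

section \<open>Zonotopes\<close>

text \<open>Signed distance from the line through \<open>0\<close> in the direction of the edge \<open>c\<close>.\<close>

definition side :: "nat \<Rightarrow> nat \<Rightarrow> complex \<Rightarrow> real" where
  "side n c z = Im (cnj (edge n c) * z)"

lemma side_add: "side n c (z + w) = side n c z + side n c w"
  by (simp add: side_def algebra_simps)

lemma side_scale: "side n c (complex_of_real r * z) = r * side n c z"
  by (simp add: side_def algebra_simps)

lemma side_sum: "side n c (\<Sum>l\<in>L. f l) = (\<Sum>l\<in>L. side n c (f l))"
  by (simp add: side_def sum_distrib_left)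

lemma side_edge: "side n c (edge n m) = sin ((real m - real c) * pi / real (2 * n + 1))"
proof -
  have "side n c (edge n m) = Im (cis ((2 * real m - 1) * pi / (2 * real (2 * n + 1)) -
      (2 * real c - 1) * pi / (2 * real (2 * n + 1))))"
    by (simp add: side_def edge_def cis_cnj cis_mult)
  also have "(2 * real m - 1) * pi / (2 * real (2 * n + 1)) -
      (2 * real c - 1) * pi / (2 * real (2 * n + 1)) = (real m - real c) * pi / real (2 * n + 1)"
    by (simp add: divide_simps) (simp add: algebra_simps)
  finally show ?thesis by simp
qed

lemma side_edge_self [simp]: "side n c (edge n c) = 0"
  by (simp add: side_edge)

text \<open>Labels differ by at most 2n, so the angle from edge c to edge m lies strictly between 0
  and pi.\<close>

lemma side_edge_pos:
  assumes "1 \<le> c" "c < m" "m \<le> 2 * n + 1"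
  shows "side n c (edge n m) > 0" "side n m (edge n c) < 0"
proof -
  have pos: "sin ((real m - real c) * pi / real (2 * n + 1)) > 0"
  proof (rule sin_gt_zero)
    have "real m - real c < real (2 * n + 1)" using assms by linarith
    then have "(real m - real c) * pi < pi * real (2 * n + 1)" by simp
    then show "(real m - real c) * pi / real (2 * n + 1) < pi"
      by (subst pos_divide_less_eq) auto
  qed (use assms in auto)
  then show "side n c (edge n m) > 0" by (simp only: side_edge)
  have "(real c - real m) * pi / real (2 * n + 1) = - ((real m - real c) * pi / real (2 * n + 1))"
    by (simp add: minus_divide_left algebra_simps)
  with pos show "side n m (edge n c) < 0" by (simp only: side_edge sin_minus)
qed

lemma edge_nonzero: "edge n c \<noteq> 0"
  by (simp add: edge_def)

text \<open>A Minkowski sum of segments, which covers rhombi and hexagons alike.\<close>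

definition zonotope :: "nat \<Rightarrow> complex \<Rightarrow> nat set \<Rightarrow> complex set" where
  "zonotope n P L = {P + (\<Sum>l\<in>L. complex_of_real (x l) * edge n l) | x. \<forall>l\<in>L. 0 \<le> x l \<and> x l \<le> 1}"

lemma zonotopeI:
  "z = P + (\<Sum>l\<in>L. complex_of_real (x l) * edge n l) \<Longrightarrow> (\<And>l. l \<in> L \<Longrightarrow> 0 \<le> x l \<and> x l \<le> 1) \<Longrightarrow>
    z \<in> zonotope n P L"
  unfolding zonotope_def by blast

text \<open>A vertex where \<open>side n c\<close> is largest: labels above c contribute positively,
  labels below negatively. The strict inequality gives c itself the coordinate 0, which leaves room
  to move along edge c.\<close>

definition extreme :: "nat \<Rightarrow> complex \<Rightarrow> nat set \<Rightarrow> nat \<Rightarrow> complex" where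
  "extreme n P L c = P + (\<Sum>l\<in>L. complex_of_real (if c < l then 1 else 0) * edge n l)"

lemma extreme_in_zonotope: "extreme n P L c \<in> zonotope n P L"
  unfolding extreme_def by (rule zonotopeI[OF refl]) auto

lemma side_term_le:
  assumes "c \<in> {1..2 * n + 1}" "l \<in> {1..2 * n + 1}" "0 \<le> x \<and> x \<le> (1::real)"
  shows "x * side n c (edge n l) \<le> (if c < l then 1 else 0) * side n c (edge n l)"
  using side_edge_pos[of c l n] side_edge_pos[of l c n] assms
  by (cases c l rule: linorder_cases) (auto simp: mult_nonneg_nonpos)

lemma side_le_extreme:
  assumes "L \<subseteq> {1..2 * n + 1}" "c \<in> {1..2 * n + 1}" "z \<in> zonotope n P L"
  shows "side n c z \<le> side n c (extreme n P L c)"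
proof -
  obtain x where x: "z = P + (\<Sum>l\<in>L. complex_of_real (x l) * edge n l)"
    "\<And>l. l \<in> L \<Longrightarrow> 0 \<le> x l \<and> x l \<le> 1"
    using assms(3) unfolding zonotope_def by blast
  show ?thesis
    unfolding x(1) extreme_def side_add side_sum side_scale
    using assms x(2) by (intro add_left_mono sum_mono side_term_le) auto
qed

lemma side_eq_extremeD:
  assumes L: "L \<subseteq> {1..2 * n + 1}" and c: "c \<in> {1..2 * n + 1}" "c \<notin> L"
    and z: "z \<in> zonotope n P L" and eq: "side n c z = side n c (extreme n P L c)"
  shows "z = extreme n P L c"
proof -
  obtain x where x: "z = P + (\<Sum>l\<in>L. complex_of_real (x l) * edge n l)"
    "\<And>l. l \<in> L \<Longrightarrow> 0 \<le> x l \<and> x l \<le> 1"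
    using z unfolding zonotope_def by blast
  have fin: "finite L" using L finite_subset by blast
  have "(\<Sum>l\<in>L. x l * side n c (edge n l)) =
      (\<Sum>l\<in>L. (if c < l then 1 else 0) * side n c (edge n l))"
    using eq unfolding x(1) extreme_def side_add side_sum side_scale by simp
  note sums = this
  \<comment> \<open>Each term is at most its counterpart, so equal sums force equal terms; as c is
    not in \<open>L\<close>, no factor vanishes and the coordinates are determined.\<close>
  have terms: "x l * side n c (edge n l) = (if c < l then 1 else 0) * side n c (edge n l)"
    if "l \<in> L" for l
    using sum_mono_inv[OF sums side_term_le[OF c(1)] that fin] L x(2) by blast
  have "x l = (if c < l then 1 else 0)" if "l \<in> L" for l
  proof -
    have "side n c (edge n l) \<noteq> 0"
      using side_edge_pos[of c l n] side_edge_pos[of l c n] that L c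
      by (cases c l rule: linorder_cases) auto
    with terms[OF that] show ?thesis by simp
  qed
  then show ?thesis unfolding x(1) extreme_def by simp
qed

text \<open>
  The face of a zonotope on which \<open>side n l\<close> is maximal is a translate of the edge \<open>l\<close> if \<open>l\<close>
  is one of its directions, and a single point otherwise.
\<close>

definition labels :: "nat \<Rightarrow> complex set \<Rightarrow> nat set" where
  "labels n Z = {l \<in> {1..2 * n + 1}.
     \<exists>z \<in> Z. z + edge n l \<in> Z \<and> (\<forall>z' \<in> Z. side n l z' \<le> side n l z)}"

lemma labels_zonotope:
  assumes L: "L \<subseteq> {1..2 * n + 1}"
  shows "labels n (zonotope n P L) = L"
proof (intro equalityI subsetI)
  fix c assume "c \<in> labels n (zonotope n P L)"
  then obtain z where c: "c \<in> {1..2 * n + 1}" and z: "z \<in> zonotope n P L"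
    "z + edge n c \<in> zonotope n P L" "\<And>z'. z' \<in> zonotope n P L \<Longrightarrow> side n c z' \<le> side n c z"
    unfolding labels_def by blast
  show "c \<in> L"
  proof (rule ccontr)
    assume "c \<notin> L"
    have "side n c z = side n c (extreme n P L c)"
      using side_le_extreme[OF L c z(1)] z(3)[OF extreme_in_zonotope] by (rule antisym)
    moreover from this have "side n c (z + edge n c) = side n c (extreme n P L c)"
      by (simp add: side_add)
    ultimately have "z = extreme n P L c" "z + edge n c = extreme n P L c"
      using side_eq_extremeD[OF L c \<open>c \<notin> L\<close>] z by auto
    then show False using edge_nonzero[of n c] by simp
  qed
next
  fix c assume c: "c \<in> L"
  have fin: "finite L" using L finite_subset by blast
  have "extreme n P L c + edge n c \<in> zonotope n P L"
  proof (rule zonotopeI)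
    \<comment> \<open>Moving along edge c raises its coordinate from 0 to 1, which turns < into
      \<le>.\<close>
    show "extreme n P L c + edge n c =
        P + (\<Sum>l\<in>L. complex_of_real (if c \<le> l then 1 else 0) * edge n l)"
      unfolding extreme_def sum.remove[OF fin c]
      by (simp add: algebra_simps) (intro sum.cong, auto)
  qed auto
  then show "c \<in> labels n (zonotope n P L)"
    unfolding labels_def using c L extreme_in_zonotope side_le_extreme[OF L] by blast
qed

text \<open>It depends on the points alone, so a tile met along two words has the same keys.\<close>

definition key :: "nat \<Rightarrow> nat \<Rightarrow> complex set \<Rightarrow> real" where
  "key n c Z = (SUP z\<in>Z. side n c z)"

lemma key_zonotope:
  assumes "L \<subseteq> {1..2 * n + 1}" "c \<in> {1..2 * n + 1}"
  shows "key n c (zonotope n P L) = side n c (extreme n P L c)"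
  unfolding key_def
  by (rule cSup_eq_maximum) (use extreme_in_zonotope side_le_extreme[OF assms] in auto)

section \<open>Rhombi and hexagons as zonotopes\<close>

lemma zonotope_two:
  assumes "a \<noteq> b"
  shows "z \<in> zonotope n P {a, b} \<longleftrightarrow> (\<exists>x y. z = P + of_real x * edge n a + of_real y * edge n b \<and>
    0 \<le> x \<and> x \<le> 1 \<and> 0 \<le> y \<and> y \<le> 1)"
proof
  assume "z \<in> zonotope n P {a, b}"
  then obtain x where "z = P + (\<Sum>l\<in>{a, b}. complex_of_real (x l) * edge n l)"
    "\<forall>l\<in>{a, b}. 0 \<le> x l \<and> x l \<le> 1"
    unfolding zonotope_def by blast
  with assms show "\<exists>x y. z = P + of_real x * edge n a + of_real y * edge n b \<and>
    0 \<le> x \<and> x \<le> 1 \<and> 0 \<le> y \<and> y \<le> 1"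
    by (intro exI[of _ "x a"] exI[of _ "x b"]) simp
next
  assume "\<exists>x y. z = P + of_real x * edge n a + of_real y * edge n b \<and>
    0 \<le> x \<and> x \<le> 1 \<and> 0 \<le> y \<and> y \<le> 1"
  then obtain x y where "z = P + of_real x * edge n a + of_real y * edge n b"
    "0 \<le> x \<and> x \<le> 1" "0 \<le> y \<and> y \<le> 1" by blast
  then show "z \<in> zonotope n P {a, b}"
    using assms by (intro zonotopeI[where x = "\<lambda>l. if l = a then x else y"]) auto
qed

lemma zonotope_three:
  assumes "a \<noteq> b" "a \<noteq> c" "b \<noteq> c"
  shows "z \<in> zonotope n P {a, b, c} \<longleftrightarrow>
    (\<exists>x y w. z = P + of_real x * edge n a + of_real y * edge n b + of_real w * edge n c \<and>
    0 \<le> x \<and> x \<le> 1 \<and> 0 \<le> y \<and> y \<le> 1 \<and> 0 \<le> w \<and> w \<le> 1)"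
proof
  assume "z \<in> zonotope n P {a, b, c}"
  then obtain x where x: "z = P + (\<Sum>l\<in>{a, b, c}. complex_of_real (x l) * edge n l)"
    "\<forall>l\<in>{a, b, c}. 0 \<le> x l \<and> x l \<le> 1"
    unfolding zonotope_def by blast
  with assms show "\<exists>x y w. z = P + of_real x * edge n a + of_real y * edge n b + of_real w * edge n c \<and>
    0 \<le> x \<and> x \<le> 1 \<and> 0 \<le> y \<and> y \<le> 1 \<and> 0 \<le> w \<and> w \<le> 1"
    by (intro exI[of _ "x a"] exI[of _ "x b"] exI[of _ "x c"]) (simp add: add.assoc)
next
  assume "\<exists>x y w. z = P + of_real x * edge n a + of_real y * edge n b + of_real w * edge n c \<and>
    0 \<le> x \<and> x \<le> 1 \<and> 0 \<le> y \<and> y \<le> 1 \<and> 0 \<le> w \<and> w \<le> 1"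
  then obtain x y w
    where "z = P + of_real x * edge n a + of_real y * edge n b + of_real w * edge n c"
    "0 \<le> x \<and> x \<le> 1" "0 \<le> y \<and> y \<le> 1" "0 \<le> w \<and> w \<le> 1" by blast
  then show "z \<in> zonotope n P {a, b, c}"
    using assms
    by (intro zonotopeI[where x = "\<lambda>l. if l = a then x else if l = b then y else w"]) auto
qed

lemma convex_hull_parallelogram:
  assumes "a \<noteq> b"
  shows "convex hull {P, P + edge n a, P + edge n a + edge n b, P + edge n b} = zonotope n P {a, b}"
    (is "convex hull ?V = ?Z")
proof
  have "convex ?Z"
    unfolding convex_alt
  proof clarify
    fix z w :: complex and r :: real
    assume "z \<in> ?Z" "w \<in> ?Z" and r: "0 \<le> r" "r \<le> 1"
    then obtain x y x' y' where
      z: "z = P + of_real x * edge n a + of_real y * edge n b" "0 \<le> x" "x \<le> 1" "0 \<le> y" "y \<le> 1" and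
      w: "w = P + of_real x' * edge n a + of_real y' * edge n b" "0 \<le> x'" "x' \<le> 1" "0 \<le> y'" "y' \<le> 1"
      unfolding zonotope_two[OF assms] by blast
    show "(1 - r) *\<^sub>R z + r *\<^sub>R w \<in> ?Z"
      unfolding zonotope_two[OF assms]
    proof (intro exI conjI)
      show "(1 - r) *\<^sub>R z + r *\<^sub>R w = P + of_real ((1 - r) * x + r * x') * edge n a +
          of_real ((1 - r) * y + r * y') * edge n b"
        unfolding z(1) w(1) by (simp add: scaleR_conv_of_real algebra_simps)
    qed (use z w r in \<open>auto intro!: convex_bound_le\<close>)
  qed
  moreover have "?V \<subseteq> ?Z"
  proof -
    have "P + of_real x * edge n a + of_real y * edge n b \<in> ?Z"
      if "0 \<le> x" "x \<le> 1" "0 \<le> y" "y \<le> 1" for x y :: real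
      unfolding zonotope_two[OF assms] using that by blast
    from this[of 0 0] this[of 1 0] this[of 1 1] this[of 0 1] show ?thesis by simp
  qed
  ultimately show "convex hull ?V \<subseteq> ?Z" by (rule hull_minimal[rotated])
next
  show "?Z \<subseteq> convex hull ?V"
  proof
    fix z assume "z \<in> ?Z"
    then obtain x y where z: "z = P + of_real x * edge n a + of_real y * edge n b"
      "0 \<le> x" "x \<le> 1" "0 \<le> y" "y \<le> 1"
      unfolding zonotope_two[OF assms] by blast
    let ?H = "convex hull ?V"
    have combine: "(1 - r) *\<^sub>R v + r *\<^sub>R w \<in> ?H" if "v \<in> ?H" "w \<in> ?H" "0 \<le> r" "r \<le> 1" for v w r
      using that convex_convex_hull[of ?V] unfolding convex_alt by blast
    have V: "v \<in> ?H" if "v \<in> ?V" for v using that by (rule hull_inc)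
    \<comment> \<open>Interpolate by x along the two sides parallel to edge a, then by y between
      them.\<close>
    have "(1 - y) *\<^sub>R ((1 - x) *\<^sub>R P + x *\<^sub>R (P + edge n a)) +
        y *\<^sub>R ((1 - x) *\<^sub>R (P + edge n b) + x *\<^sub>R (P + edge n a + edge n b)) \<in> ?H"
      using z by (intro combine V) auto
    also have "(1 - y) *\<^sub>R ((1 - x) *\<^sub>R P + x *\<^sub>R (P + edge n a)) +
        y *\<^sub>R ((1 - x) *\<^sub>R (P + edge n b) + x *\<^sub>R (P + edge n a + edge n b)) = z"
      unfolding z(1) by (simp add: scaleR_conv_of_real algebra_simps)
    finally show "z \<in> ?H" .
  qed
qed

text \<open>The two directions lie at equal angles d < pi/2 on both sides of edge n + 1, so their
  sum is 2 cos d times that edge.\<close>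

lemma edge_opposite:
  assumes "1 \<le> a" "a < n + 1"
  shows "\<exists>k > 0. edge n a + edge n (2 * n + 2 - a) = complex_of_real k * edge n (n + 1)"
proof (intro exI conjI)
  define d where "d = (real (n + 1) - real a) * pi / real (2 * n + 1)"
  define m where "m = pi + (2 * real (n + 1) - 1) * pi / (2 * real (2 * n + 1))"
  have b: "real (2 * n + 2 - a) = 2 * real (n + 1) - real a"
    using assms by (simp add: of_nat_diff)
  have "edge n a = cis (m - d)"
    unfolding edge_def d_def m_def
    by (rule arg_cong[where f = cis]) (simp add: divide_simps, simp add: algebra_simps)
  moreover have "edge n (2 * n + 2 - a) = cis (m + d)"
    unfolding edge_def d_def m_def b
    by (rule arg_cong[where f = cis]) (simp add: divide_simps, simp add: algebra_simps)
  moreover have "edge n (n + 1) = cis m" by (simp add: edge_def m_def)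
  ultimately show "edge n a + edge n (2 * n + 2 - a) =
      complex_of_real (2 * cos d) * edge n (n + 1)"
    by (simp add: complex_eq_iff cos_add cos_diff sin_add sin_diff)
  have "0 \<le> d" "d < pi / 2"
  proof -
    show "0 \<le> d" unfolding d_def using assms by simp
    have "real a \<ge> 1" using assms by simp
    then have "2 * (real (n + 1) - real a) < real (2 * n + 1)" by simp
    then have "2 * (real (n + 1) - real a) * pi < real (2 * n + 1) * pi" by simp
    then show "d < pi / 2" unfolding d_def by (simp add: divide_simps algebra_simps)
  qed
  then show "0 < 2 * cos d" using cos_gt_zero_pi[of d] by simp
qed

text \<open>
  A point of the hexagon has a one-parameter family of coordinates, because the middle edge is a
  positive combination of the outer ones. Moving along the family until a coordinate hits
  the boundary puts the point into one of three rhombi; the two directions give the two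
  decompositions.
\<close>

lemma hexagon_decompositions:
  assumes ne: "a \<noteq> b" "a \<noteq> c" "b \<noteq> c" and k: "k > 0"
    and rel: "edge n a + edge n b = complex_of_real k * edge n c"
  shows "zonotope n P {a, c} \<union> zonotope n (P + edge n c) {a, b} \<union> zonotope n P {c, b} =
      zonotope n P {a, b, c}" (is "?U = ?Z")
    and "zonotope n (P + edge n a) {c, b} \<union> zonotope n P {a, b} \<union> zonotope n (P + edge n b) {a, c} =
      zonotope n P {a, b, c}" (is "?U' = ?Z")
proof -
  note two = zonotope_two[OF ne(1)] zonotope_two[OF ne(2)] zonotope_two[OF ne(3)[symmetric]]
  note three = zonotope_three[OF ne]
  have three_I: "z \<in> ?Z"
    if "z = P + of_real x * edge n a + of_real y * edge n b + of_real w * edge n c"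
      "0 \<le> x" "x \<le> 1" "0 \<le> y" "y \<le> 1" "0 \<le> w" "w \<le> 1" for z x y w
    unfolding three using that by blast
  have "?U \<subseteq> ?Z"
  proof
    fix z assume "z \<in> ?U"
    then consider "z \<in> zonotope n P {a, c}" | "z \<in> zonotope n (P + edge n c) {a, b}"
      | "z \<in> zonotope n P {c, b}" by blast
    then show "z \<in> ?Z"
    proof cases
      case 1
      then obtain p q where "z = P + of_real p * edge n a + of_real q * edge n c"
        "0 \<le> p" "p \<le> 1" "0 \<le> q" "q \<le> 1"
        unfolding two by blast
      then show ?thesis by (intro three_I[of z p 0 q]) simp_all
    next
      case 2
      then obtain p q where "z = P + edge n c + of_real p * edge n a + of_real q * edge n b"
        "0 \<le> p" "p \<le> 1" "0 \<le> q" "q \<le> 1"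
        unfolding two by blast
      then show ?thesis by (intro three_I[of z p q 1]) simp_all
    next
      case 3
      then obtain p q where "z = P + of_real p * edge n c + of_real q * edge n b"
        "0 \<le> p" "p \<le> 1" "0 \<le> q" "q \<le> 1"
        unfolding two by blast
      then show ?thesis by (intro three_I[of z 0 q p]) simp_all
    qed
  qed
  moreover have "?U' \<subseteq> ?Z"
  proof
    fix z assume "z \<in> ?U'"
    then consider "z \<in> zonotope n (P + edge n a) {c, b}" | "z \<in> zonotope n P {a, b}"
      | "z \<in> zonotope n (P + edge n b) {a, c}" by blast
    then show "z \<in> ?Z"
    proof cases
      case 1
      then obtain p q where "z = P + edge n a + of_real p * edge n c + of_real q * edge n b"
        "0 \<le> p" "p \<le> 1" "0 \<le> q" "q \<le> 1"
        unfolding two by blast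
      then show ?thesis by (intro three_I[of z 1 q p]) simp_all
    next
      case 2
      then obtain p q where "z = P + of_real p * edge n a + of_real q * edge n b"
        "0 \<le> p" "p \<le> 1" "0 \<le> q" "q \<le> 1"
        unfolding two by blast
      then show ?thesis by (intro three_I[of z p q 0]) simp_all
    next
      case 3
      then obtain p q where "z = P + edge n b + of_real p * edge n a + of_real q * edge n c"
        "0 \<le> p" "p \<le> 1" "0 \<le> q" "q \<le> 1"
        unfolding two by blast
      then show ?thesis by (intro three_I[of z p 1 q]) simp_all
    qed
  qed
  moreover have "?Z \<subseteq> ?U \<inter> ?U'"
  proof
    fix z assume "z \<in> ?Z"
    then obtain x y w where
      z: "z = P + of_real x * edge n a + of_real y * edge n b + of_real w * edge n c"
      and bounds: "0 \<le> x" "x \<le> 1" "0 \<le> y" "y \<le> 1" "0 \<le> w" "w \<le> 1"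
      unfolding three by blast
    have shift: "z = P + of_real (x - r) * edge n a + of_real (y - r) * edge n b +
        of_real (w + k * r) * edge n c" for r
    proof -
      have "of_real r * edge n a + of_real r * edge n b = of_real (k * r) * edge n c"
        using arg_cong[OF rel, of "\<lambda>v. of_real r * v"] by (simp add: algebra_simps)
      then show ?thesis unfolding z by (simp add: algebra_simps)
    qed
    have "z \<in> ?U"
    proof -
      \<comment> \<open>The largest shift that trades edges a and b for edge c within the unit
        ranges: it stops when x or y reaches 0 or the coordinate of c reaches 1.\<close>
      define r where "r = min (min x y) ((1 - w) / k)"
      have "0 \<le> r" "r \<le> x" "r \<le> y" "r \<le> (1 - w) / k"
        using bounds k by (simp_all add: r_def)
      then have r: "0 \<le> r" "r \<le> x" "r \<le> y" "k * r \<le> 1 - w"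
        using k by (simp_all add: pos_le_divide_eq mult.commute)
      have "r = x \<or> r = y \<or> r = (1 - w) / k" by (auto simp: r_def min_def)
      then consider "r = x" | "r = y" | "k * r = 1 - w" using k by fastforce
      then show ?thesis
      proof cases
        case 1
        then have "z \<in> zonotope n P {c, b}"
          unfolding two using shift[of r] r bounds k
          by (intro exI[of _ "w + k * r"] exI[of _ "y - r"]) (auto simp: algebra_simps)
        then show ?thesis by blast
      next
        case 2
        then have "z \<in> zonotope n P {a, c}"
          unfolding two using shift[of r] r bounds k
          by (intro exI[of _ "x - r"] exI[of _ "w + k * r"]) (auto simp: algebra_simps)
        then show ?thesis by blast
      next
        case 3
        then have "z \<in> zonotope n (P + edge n c) {a, b}"
          unfolding two using shift[of r] r bounds k
          by (intro exI[of _ "x - r"] exI[of _ "y - r"]) (auto simp: algebra_simps)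
        then show ?thesis by blast
      qed
    qed
    moreover have "z \<in> ?U'"
    proof -
      \<comment> \<open>The opposite shift: it stops when x or y reaches 1 or the coordinate of c
        reaches 0.\<close>
      define r where "r = min (min (1 - x) (1 - y)) (w / k)"
      have "0 \<le> r" "r \<le> 1 - x" "r \<le> 1 - y" "r \<le> w / k"
        using bounds k by (simp_all add: r_def)
      then have r: "0 \<le> r" "r \<le> 1 - x" "r \<le> 1 - y" "k * r \<le> w"
        using k by (simp_all add: pos_le_divide_eq mult.commute)
      define x' y' w' where "x' = x + r" and "y' = y + r" and "w' = w - k * r"
      have "0 \<le> k * r" using r k by simp
      then have bounds': "0 \<le> x'" "x' \<le> 1" "0 \<le> y'" "y' \<le> 1" "0 \<le> w'" "w' \<le> 1"
        using r bounds unfolding x'_def y'_def w'_def by linarith+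
      have z': "z = P + of_real x' * edge n a + of_real y' * edge n b + of_real w' * edge n c"
        using shift[of "- r"] by (simp add: x'_def y'_def w'_def)
      have "r = 1 - x \<or> r = 1 - y \<or> r = w / k" by (auto simp: r_def min_def)
      then consider "x' = 1" | "y' = 1" | "w' = 0"
        using k unfolding x'_def y'_def w'_def by fastforce
      then show ?thesis
      proof cases
        case 1
        then have "z = P + edge n a + of_real w' * edge n c + of_real y' * edge n b"
          using z' by simp
        then have "z \<in> zonotope n (P + edge n a) {c, b}"
          unfolding two using bounds' by blast
        then show ?thesis by blast
      next
        case 2
        then have "z = P + edge n b + of_real x' * edge n a + of_real w' * edge n c"
          using z' by simp
        then have "z \<in> zonotope n (P + edge n b) {a, c}"
          unfolding two using bounds' by blast
        then show ?thesis by blast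
      next
        case 3
        then have "z = P + of_real x' * edge n a + of_real y' * edge n b"
          using z' by simp
        then have "z \<in> zonotope n P {a, b}"
          unfolding two using bounds' by blast
        then show ?thesis by blast
      qed
    qed
    ultimately show "z \<in> ?U \<inter> ?U'" by blast
  qed
  ultimately show "?U = ?Z" "?U' = ?Z" by blast+
qed

section \<open>Paths and tiles\<close>

lemma B_Suc: "B n u (Suc j) = B n u j + edge n (inv' u (Suc j))"
  by (simp add: B_def)

text \<open>A partial sum of length k \<noteq> i contains both swapped edges or neither.\<close>

lemma B_s_other:
  assumes "bij u" "1 \<le> i" "k \<noteq> i"
  shows "B n (s i \<circ> u) k = B n u k"
proof -
  have "(\<Sum>r = 1..k. edge n (inv' u (s i r))) = (\<Sum>r = 1..k. edge n (inv' u r))"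
  proof (cases "k < i")
    case True
    then show ?thesis by (intro sum.cong) (auto simp: s_apply)
  next
    case False
    have "s i permutes {1..k}"
      unfolding s_def using assms False by (intro permutes_swap_id) auto
    from sum.permute[OF this, of "\<lambda>r. edge n (inv' u r)"] show ?thesis by (simp add: comp_def)
  qed
  then show ?thesis by (simp add: B_def inv_s_comp[OF assms(1)])
qed

lemma B_s_at:
  assumes "bij u" "1 \<le> i"
  shows "B n (s i \<circ> u) i = B n u (i - 1) + edge n (inv' u (i + 1))"
proof -
  obtain j where j: "i = Suc j" using assms(2) by (cases i) auto
  show ?thesis
    unfolding j B_Suc inv_s_comp[OF assms(1)] using B_s_other[OF assms(1), of "Suc j" j n]
    by (simp add: s_apply)
qed

lemma bij_s_comp: "bij u \<Longrightarrow> bij (s i \<circ> u)"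
  by (rule bij_comp) (simp_all add: s_def)

lemma inv_neq: "bij u \<Longrightarrow> j \<noteq> k \<Longrightarrow> inv' u j \<noteq> inv' u k"
  by (metis bij_inv_eq_iff)

lemma rhombus_zonotope:
  assumes "bij u" "1 \<le> i"
  shows "rhombus n u i = zonotope n (B n u (i - 1)) {inv' u i, inv' u (i + 1)}"
proof -
  obtain j where j: "i = Suc j" using assms(2) by (cases i) auto
  have "B n u i = B n u (i - 1) + edge n (inv' u i)"
    "B n u (i + 1) = B n u (i - 1) + edge n (inv' u i) + edge n (inv' u (i + 1))"
    by (simp_all add: j B_Suc)
  then show ?thesis
    using convex_hull_parallelogram[of "inv' u i" "inv' u (i + 1)"] inv_neq[OF assms(1)]
    by (simp add: rhombus_def B_s_at[OF assms])
qed

lemma rhombus_s_distant: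
  assumes "bij u" "1 \<le> i" "1 \<le> j" "i + 1 < j \<or> j + 1 < i"
  shows "rhombus n (s j \<circ> u) i = rhombus n u i"
proof -
  have "i - 1 \<noteq> j" "s j i = i" "s j (i + 1) = i + 1" using assms(4) by (auto simp: s_apply)
  with B_s_other[OF assms(1,3) this(1)] show ?thesis
    unfolding rhombus_zonotope[OF assms(1,2)] rhombus_zonotope[OF bij_s_comp[OF assms(1)] assms(2)]
      inv_s_comp[OF assms(1)] by (simp only:)
qed

section \<open>Tiles attached to the letters of T\<close>

definition tile :: "nat \<Rightarrow> (nat \<Rightarrow> nat) \<Rightarrow> nat \<times> nat \<Rightarrow> complex set" where
  "tile n u = (\<lambda>(j, k). zonotope n (B n u (j - 1)) (inv' u ` {j..k}))"

text \<open>The ranges of positions that t_i reverses, see \<open>interval_facts\<close>: one range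
  for the hexagon, two mirror images otherwise.\<close>

definition intervals :: "nat \<Rightarrow> nat \<Rightarrow> (nat \<times> nat) set" where
  "intervals n i =
     (if i = 1 then {(n, n + 2)} else {(n + 1 - i, n + 1 - i + 1), (n + i, n + i + 1)})"

definition step_tiles :: "nat \<Rightarrow> (nat \<Rightarrow> nat) \<Rightarrow> nat \<Rightarrow> complex set set" where
  "step_tiles n u i = tile n u ` intervals n i"

lemma tile_rhombus:
  assumes "bij u" "1 \<le> j"
  shows "tile n u (j, j + 1) = rhombus n u j"
proof -
  have "{j..j + 1} = {j, j + 1}" by auto
  then show ?thesis by (simp add: tile_def rhombus_zonotope[OF assms])
qed

text \<open>For i \<ge> 2 the two letters of a block act far apart, so their order does not change
  the rhombi. For i = 1 the two words produce the two decompositions of one hexagon.\<close>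

lemma block_tiles_eq:
  assumes u: "u \<in> symmetric_perms n" and i: "i \<in> {1..n}"
    and asc: "inv' u (n + i) < inv' u (n + i + 1)" and b: "b \<in> blocks n i"
  shows "block_tiles n u b = step_tiles n u i"
proof (cases "i = 1")
  case False
  have bij: "bij u" using symmetric_permsD(2)[OF u] .
  have n: "1 \<in> {1..n}" using i by auto
  have "b \<notin> blocks n 1" using b False by (auto simp: blocks_def)
  then have "block_tiles n u b = rhombi n u b"
    by (simp only: block_tiles_def reduced_words_W_t[OF n] if_False)
  also have "\<dots> = {rhombus n u (n + 1 - i), rhombus n u (n + i)}"
  proof -
    have ge: "1 \<le> n + 1 - i" "1 \<le> n + i" and lt: "n + 1 - i + 1 < n + i" using i False by auto
    have "rhombus n (s (n + i) \<circ> u) (n + 1 - i) = rhombus n u (n + 1 - i)"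
      "rhombus n (s (n + 1 - i) \<circ> u) (n + i) = rhombus n u (n + i)"
      using rhombus_s_distant[OF bij] ge lt by blast+
    then show ?thesis
      using b False by (auto simp: blocks_def word_prod_W)
  qed
  also have "\<dots> = step_tiles n u i"
  proof -
    have ge: "1 \<le> n + 1 - i" "1 \<le> n + i" using i by auto
    show ?thesis
      unfolding step_tiles_def intervals_def using False
      by (simp only: if_False image_insert image_empty tile_rhombus[OF bij ge(1)]
          tile_rhombus[OF bij ge(2)])
  qed
  finally show ?thesis .
next
  case True
  have bij: "bij u" using symmetric_permsD(2)[OF u] .
  have bij': "bij (s j \<circ> u)" "bij (s k \<circ> (s j \<circ> u))" for j k
    using bij_s_comp bij by auto
  have n: "1 \<le> n" "1 \<in> {1..n}" using i by auto
  let ?a = "inv' u n" and ?c = "inv' u (n + 1)" and ?b = "inv' u (n + 2)"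
  let ?P = "B n u (n - 1)"
  have range: "?b \<le> 2 * n + 1"
    using permutes_in_image[OF permutes_inv[OF symmetric_permsD(1)[OF u]], of "n + 2"] n by simp
  have c: "?c = n + 1" by (rule inv_symmetric_middle[OF u])
  have a: "?a = 2 * n + 2 - ?b" using inv_symmetric[OF u, of "n + 2"] n by simp
  \<comment> \<open>The ascent puts the outer labels on the two sides of n + 1, as
    \<open>edge_opposite\<close> requires.\<close>
  have "?b > n + 1" using asc True c by simp
  then have a': "1 \<le> ?a" "?a < n + 1" "?b = 2 * n + 2 - ?a" using a range by auto
  then obtain k where k: "k > 0" "edge n ?a + edge n ?b = complex_of_real k * edge n ?c"
    using edge_opposite[OF a'(1,2)] c by auto
  have ne: "?a \<noteq> ?b" "?a \<noteq> ?c" "?b \<noteq> ?c" using inv_neq[OF bij] by auto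
  note hexagon = hexagon_decompositions[OF ne k]
  have "{n..n + 2} = {n, n + 2, n + 1}" by auto
  then have tile: "step_tiles n u i = {zonotope n ?P {?a, ?b, ?c}}"
    using True by (simp add: step_tiles_def intervals_def tile_def)
  have B1: "B n (s n \<circ> u) n = ?P + edge n ?c" by (rule B_s_at[OF bij n(1)])
  have B2: "B n (s n \<circ> u) (n - 1) = ?P" "B n (s (n + 1) \<circ> u) (n - 1) = ?P"
    "B n (s (n + 1) \<circ> (s n \<circ> u)) (n - 1) = ?P"
    using n by (simp_all add: B_s_other bij bij')
  have B3: "B n u n = ?P + edge n ?a" using B_Suc[of n u "n - 1"] n by simp
  have B4: "B n (s n \<circ> (s (n + 1) \<circ> u)) n = ?P + edge n ?b"
    using B_s_at[OF bij'(1) n(1), of n "n + 1"] B2 by (simp add: inv_s_comp[OF bij] s_apply)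
  have ge: "1 \<le> n + 1" and two: "n + 1 + 1 = n + 2" by simp_all
  have "\<Union> (rhombi n u b) = zonotope n ?P {?a, ?b, ?c}"
  proof -
    consider "b = [n, n + 1, n]" | "b = [n + 1, n, n + 1]"
      using b True by (auto simp: blocks_def)
    then show ?thesis
    proof cases
      case 1
      then have "\<Union> (rhombi n u b) = rhombus n u n \<union> rhombus n (s n \<circ> u) (n + 1) \<union>
          rhombus n (s (n + 1) \<circ> (s n \<circ> u)) n"
        by (auto simp: word_prod_W Fun.comp_assoc)
      also have "\<dots> = zonotope n ?P {?a, ?c} \<union> zonotope n (?P + edge n ?c) {?a, ?b} \<union>
          zonotope n ?P {?c, ?b}"
        using n by (simp add: rhombus_zonotope[OF bij n(1)] rhombus_zonotope[OF bij'(1) ge]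
            rhombus_zonotope[OF bij'(2) n(1)] B1 B2 B3 inv_s_comp bij bij' s_apply two
            del: One_nat_def add_2_eq_Suc add_2_eq_Suc')
      finally show ?thesis using hexagon by simp
    next
      case 2
      then have "\<Union> (rhombi n u b) = rhombus n u (n + 1) \<union> rhombus n (s (n + 1) \<circ> u) n \<union>
          rhombus n (s n \<circ> (s (n + 1) \<circ> u)) (n + 1)"
        by (auto simp: word_prod_W Fun.comp_assoc)
      also have "\<dots> = zonotope n (?P + edge n ?a) {?c, ?b} \<union> zonotope n ?P {?a, ?b} \<union>
          zonotope n (?P + edge n ?b) {?a, ?c}"
        using n by (simp add: rhombus_zonotope[OF bij ge] rhombus_zonotope[OF bij'(1) n(1)]
            rhombus_zonotope[OF bij'(2) ge] B2 B3 B4 inv_s_comp bij bij' s_apply two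
            del: One_nat_def add_2_eq_Suc add_2_eq_Suc')
      finally show ?thesis using hexagon by simp
    qed
  qed
  then show ?thesis
    using b tile unfolding True by (simp only: block_tiles_def reduced_words_W_t[OF n(2)] if_True)
qed

lemma interval_facts:
  assumes i: "i \<in> {1..n}" and jk: "(j, k) \<in> intervals n i"
  shows "1 \<le> j" "j < k" "k \<le> 2 * n + 1"
    and "\<And>l. l \<in> {j..k} \<Longrightarrow> t n i l = j + k - l"
    and "\<And>l. l \<in> {j..k} \<Longrightarrow> \<exists>r \<in> set (block n i). l \<in> {r, r + 1}"
proof -
  show range: "1 \<le> j" "j < k" "k \<le> 2 * n + 1"
    using assms by (auto simp: intervals_def split: if_splits)
  fix l assume l: "l \<in> {j..k}"
  show "\<exists>r \<in> set (block n i). l \<in> {r, r + 1}"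
    using l jk by (cases "i = 1") (auto simp: intervals_def block_def)
  show "t n i l = j + k - l"
  proof (cases "i = 1")
    case True
    then have "j = n" "k = n + 2" using jk by (auto simp: intervals_def)
    with l show ?thesis unfolding True t_one_apply by auto
  next
    case False
    have *: "n + 1 - i + 1 = n + 2 - i" "n + 2 - i < n + i" using i False by auto
    have "(l = j \<or> l = k) \<and> k = j + 1" "j = n + 1 - i \<or> j = n + i"
      using l jk False by (auto simp: intervals_def)
    then show ?thesis using * False unfolding t_apply[OF i] by auto
  qed
qed

text \<open>A letter moves only the vertex whose index it is, so a vertex whose index is not in the
  block stays.\<close>

lemma B_t_other:
  assumes "bij u" "i \<in> {1..n}" "k \<notin> set (block n i)"
  shows "B n (t n i \<circ> u) k = B n u k"
proof -
  have "\<forall>j \<in> set w. 1 \<le> j \<and> k \<noteq> j \<Longrightarrow>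
      bij (perm_prod s w \<circ> u) \<and> B n (perm_prod s w \<circ> u) k = B n u k" for w
  proof (induction w)
    case (Cons j w)
    have IH: "bij (perm_prod s w \<circ> u) \<and> B n (perm_prod s w \<circ> u) k = B n u k"
      by (rule Cons.IH) (use Cons.prems in simp)
    have "bij (s j \<circ> (perm_prod s w \<circ> u)) \<and> B n (s j \<circ> (perm_prod s w \<circ> u)) k = B n u k"
      using IH bij_s_comp[of "perm_prod s w \<circ> u" j] B_s_other[of "perm_prod s w \<circ> u" j k n]
        Cons.prems by simp
    then show ?case unfolding perm_prod_simps Fun.comp_assoc .
  qed (use assms(1) in simp)
  moreover have "\<forall>j \<in> set (block n i). 1 \<le> j \<and> k \<noteq> j"
    using block_in_lists[OF assms(2)] assms(3) by auto
  ultimately show ?thesis by (metis perm_prod_block)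
qed

lemma B_t_before:
  assumes u: "bij u" and i: "i \<in> {1..n}" and jk: "(j, k) \<in> intervals n i"
  shows "B n (t n i \<circ> u) (j - 1) = B n u (j - 1)"
proof (rule B_t_other[OF u i])
  show "j - 1 \<notin> set (block n i)"
    using i jk by (cases "i = 1") (auto simp: block_def intervals_def)
qed

lemma ascending_on_interval:
  assumes u: "u \<in> symmetric_perms n" and i: "i \<in> {1..n}"
    and asc: "inv' u (n + i) < inv' u (n + i + 1)" and jk: "(j, k) \<in> intervals n i"
    and l: "j \<le> l" "l < r" "r \<le> k"
  shows "inv' u l < inv' u r"
proof -
  have range: "inv' u (n + i + 1) \<le> 2 * n + 1"
    using permutes_in_image[OF permutes_inv[OF symmetric_permsD(1)[OF u]], of "n + i + 1"] i by simp
  show ?thesis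
  proof (cases "i = 1")
    case True
    have "inv' u n = 2 * n + 2 - inv' u (n + 2)"
      using inv_symmetric[OF u, of "n + 2"] i by simp
    then have "inv' u n < inv' u (n + 1)" "inv' u (n + 1) < inv' u (n + 2)"
      using asc range True inv_symmetric_middle[OF u] by auto
    moreover have "l = n \<and> r = n + 1 \<or> l = n \<and> r = n + 2 \<or> l = n + 1 \<and> r = n + 2"
      using jk l True by (auto simp: intervals_def)
    ultimately show ?thesis by auto
  next
    case False
    have "2 * n + 2 - (n + i + 1) = n + 1 - i" "2 * n + 2 - (n + i) = n + 1 - i + 1"
      using i by auto
    then have "inv' u (n + 1 - i) = 2 * n + 2 - inv' u (n + i + 1)"
      "inv' u (n + 1 - i + 1) = 2 * n + 2 - inv' u (n + i)"
      using inv_symmetric[OF u, of "n + i + 1"] inv_symmetric[OF u, of "n + i"] i by auto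
    then have "inv' u (n + 1 - i) < inv' u (n + 1 - i + 1)"
      using asc range by linarith
    moreover have "l = n + 1 - i \<and> r = n + 1 - i + 1 \<or> l = n + i \<and> r = n + i + 1"
      using jk l False by (auto simp: intervals_def)
    ultimately show ?thesis using asc by auto
  qed
qed

text \<open>Phrased with the permutation after the step, where the keys will be read off; t_i maps
  the range to itself, so the labels in it are the same before and after.\<close>

lemma labels_tile:
  assumes u: "u \<in> symmetric_perms n" and i: "i \<in> {1..n}" and jk: "(j, k) \<in> intervals n i"
  shows "labels n (tile n u (j, k)) = {c. (t n i \<circ> u) c \<in> {j..k}}"
proof -
  note perm = symmetric_permsD(1)[OF u] and jk_facts = interval_facts[OF i jk]
  have "inv' u ` {j..k} \<subseteq> {1..2 * n + 1}"
    using permutes_in_image[OF permutes_inv[OF perm]] jk_facts(1-3) by force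
  then have "labels n (tile n u (j, k)) = inv' u ` {j..k}"
    by (simp add: tile_def labels_zonotope)
  also have "\<dots> = {c. u c \<in> {j..k}}"
    using permutes_inverses[OF perm] by (auto simp: image_iff) (metis atLeastAtMost_iff)
  also have "\<dots> = {c. (t n i \<circ> u) c \<in> {j..k}}"
  proof -
    have stable: "t n i l \<in> {j..k}" if "l \<in> {j..k}" for l
      using jk_facts(4)[OF that] that by auto
    have "u c \<in> {j..k} \<longleftrightarrow> t n i (u c) \<in> {j..k}" for c
      using stable[of "u c"] stable[of "t n i (u c)"] unfolding t_invol(1)[OF i] by blast
    then show ?thesis by simp
  qed
  finally show ?thesis .
qed

text \<open>The vertex is the end of the edge labelled c on the path. Since \<open>side n c\<close>
  is constant along this edge, the value is its signed distance from the parallel line through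
  0.\<close>

definition potential :: "nat \<Rightarrow> nat \<Rightarrow> (nat \<Rightarrow> nat) \<Rightarrow> real" where
  "potential n c u = side n c (B n u (u c))"

text \<open>On the increasing run j..k the labels above c are exactly those after c, so the maximum
  is reached by taking them first and then c. The reversed path after the step does just
  that.\<close>

lemma key_tile:
  assumes u: "u \<in> symmetric_perms n" and i: "i \<in> {1..n}"
    and asc: "inv' u (n + i) < inv' u (n + i + 1)" and jk: "(j, k) \<in> intervals n i"
    and c: "(t n i \<circ> u) c \<in> {j..k}"
  shows "key n c (tile n u (j, k)) = potential n c (t n i \<circ> u)"
proof -
  note perm = symmetric_permsD(1)[OF u] and jk_facts = interval_facts[OF i jk]
  have bij: "bij u" using symmetric_permsD(2)[OF u] .
  define l where "l = u c"
  have cl: "c = inv' u l" using permutes_inverses(2)[OF perm] by (simp add: l_def)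
  have "l = t n i (t n i l)" using t_invol(1)[OF i] by simp
  also have "\<dots> = j + k - t n i l" using jk_facts(4) c by (simp add: l_def)
  finally have l: "l \<in> {j..k}" using c jk_facts(2) by (auto simp: l_def)
  have L: "inv' u ` {j..k} \<subseteq> {1..2 * n + 1}"
    using permutes_in_image[OF permutes_inv[OF perm]] jk_facts(1-3) by force
  then have c_range: "c \<in> {1..2 * n + 1}" using imageI[OF l, of "inv' u"] cl by blast
  let ?e = "\<lambda>r. side n c (edge n (inv' u r))"
  have inj: "inj_on (inv' u) {j..k}"
    using permutes_inj[OF permutes_inv[OF perm]] by (rule inj_on_subset) simp
  have "key n c (tile n u (j, k)) = side n c (B n u (j - 1)) +
      (\<Sum>r\<in>{j..k}. (if c < inv' u r then 1 else 0) * ?e r)"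
    by (simp only: tile_def case_prod_conv key_zonotope[OF L c_range] extreme_def side_add side_sum
        side_scale sum.reindex[OF inj] comp_def)
  \<comment> \<open>The label c at position l may be kept in the sum, because its own
    \<open>side\<close> is 0.\<close>
  also have "(\<Sum>r\<in>{j..k}. (if c < inv' u r then 1 else 0) * ?e r) = (\<Sum>r\<in>{l..k}. ?e r)"
  proof (rule sum.mono_neutral_cong_right)
    show "\<forall>r \<in> {j..k} - {l..k}. (if c < inv' u r then 1 else 0) * ?e r = 0"
    proof
      fix r assume "r \<in> {j..k} - {l..k}"
      then have "inv' u r < inv' u l"
        using ascending_on_interval[OF u i asc jk, of r l] l by auto
      then show "(if c < inv' u r then 1 else 0) * ?e r = 0" using cl by simp
    qed
    fix r assume "r \<in> {l..k}"
    then show "(if c < inv' u r then 1 else 0) * ?e r = ?e r"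
      using ascending_on_interval[OF u i asc jk, of l r] l cl by (cases "r = l") auto
  qed (use l in auto)
  also have "(\<Sum>r\<in>{l..k}. ?e r) = (\<Sum>r\<in>{j..j + k - l}. side n c (edge n (inv' (t n i \<circ> u) r)))"
  proof (rule sum.reindex_bij_witness[of _ "\<lambda>r. j + k - r" "\<lambda>r. j + k - r"])
    fix r assume r: "r \<in> {l..k}"
    then have "j + k - r \<in> {j..k}" "j + k - (j + k - r) = r" using l by auto
    then have "t n i (j + k - r) = r" using jk_facts(4)[of "j + k - r"] by simp
    then show "side n c (edge n (inv' (t n i \<circ> u) (j + k - r))) = ?e r"
      by (simp only: inv_t_comp[OF bij i])
  qed (use l in auto)
  also have "side n c (B n u (j - 1)) + \<dots> = side n c (B n (t n i \<circ> u) (j + k - l))"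
  proof -
    have "{1..j + k - l} = {1..j - 1} \<union> {j..j + k - l}" using l jk_facts(1) by auto
    moreover have "{1..j - 1} \<inter> {j..j + k - l} = {}" using jk_facts(1) by auto
    ultimately have "B n (t n i \<circ> u) (j + k - l) = B n (t n i \<circ> u) (j - 1) +
        (\<Sum>r\<in>{j..j + k - l}. edge n (inv' (t n i \<circ> u) r))"
      unfolding B_def by (simp only: sum.union_disjoint[OF finite_atLeastAtMost finite_atLeastAtMost])
    then show ?thesis by (simp only: B_t_before[OF bij i jk] side_add side_sum)
  qed
  also have "j + k - l = (t n i \<circ> u) c" using jk_facts(4)[OF l] by (simp add: l_def)
  finally show ?thesis by (simp only: potential_def)
qed

text \<open>If c stands at j, its end gains a larger label, which has positive side; if at j + 1, it
  loses a smaller one, which has negative side.\<close>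

lemma potential_s:
  assumes u: "u permutes {1..2 * n + 1}" and j: "j \<in> {1..2 * n}"
    and asc: "inv' u j < inv' u (j + 1)"
  shows "potential n c u \<le> potential n c (s j \<circ> u)"
    and "u c \<in> {j, j + 1} \<Longrightarrow> potential n c u < potential n c (s j \<circ> u)"
proof -
  have bij: "bij u" using permutes_bij[OF u] .
  have range: "inv' u j \<in> {1..2 * n + 1}" "inv' u (j + 1) \<in> {1..2 * n + 1}"
    using permutes_in_image[OF permutes_inv[OF u]] j by auto
  have c: "c = inv' u (u c)" using permutes_inverses(2)[OF u] by simp
  obtain i where i: "j = Suc i" using j by (cases j) auto
  have first: "potential n c u < potential n c (s j \<circ> u)" if "u c = j"
  proof -
    have "potential n c (s j \<circ> u) = potential n c u + side n c (edge n (inv' u (j + 1)))"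
      using that B_s_other[OF bij, of j "j + 1" n] j
      by (simp add: potential_def s_apply B_Suc side_add)
    moreover have "side n c (edge n (inv' u (j + 1))) > 0"
      using side_edge_pos(1)[of c "inv' u (j + 1)" n] c that range asc by auto
    ultimately show ?thesis by simp
  qed
  have second: "potential n c u < potential n c (s j \<circ> u)" if "u c = j + 1"
  proof -
    have "potential n c u = potential n c (s j \<circ> u) + side n c (edge n (inv' u j))"
      using that B_s_at[OF bij, of j n] i
      by (simp add: potential_def s_apply B_Suc side_add)
    moreover have "side n c (edge n (inv' u j)) < 0"
      using side_edge_pos(2)[of "inv' u j" c n] c that range asc by auto
    ultimately show ?thesis by simp
  qed
  have "potential n c u = potential n c (s j \<circ> u)" if "u c \<notin> {j, j + 1}"
    using that B_s_other[OF bij, of j "u c" n] j by (simp add: potential_def s_apply)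
  with first second show "potential n c u \<le> potential n c (s j \<circ> u)"
    by (cases "u c \<in> {j, j + 1}") auto
  show "u c \<in> {j, j + 1} \<Longrightarrow> potential n c u < potential n c (s j \<circ> u)"
    using first second by auto
qed

text \<open>By monotonicity, equality between both ends of the word means equality at every letter,
  and a letter touching the position of c would be strict.\<close>

lemma potential_ascending:
  assumes u: "u permutes {1..2 * n + 1}" and "w \<in> lists {1..2 * n}" "ascending u w"
  shows "potential n c u \<le> potential n c (perm_prod s w \<circ> u) \<and>
    (potential n c u = potential n c (perm_prod s w \<circ> u) \<longrightarrow>
      (perm_prod s w \<circ> u) c = u c \<and> (\<forall>j \<in> set w. u c \<notin> {j, j + 1}))"
  using assms(2,3)
proof (induction w rule: list.induct)
  case (Cons j w)
  then have mem: "j \<in> {1..2 * n}" "w \<in> lists {1..2 * n}" "ascending u w"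
    and asc: "inv' (perm_prod s w \<circ> u) j < inv' (perm_prod s w \<circ> u) (j + 1)" by auto
  define v where "v = perm_prod s w \<circ> u"
  have v: "v permutes {1..2 * n + 1}"
    unfolding v_def by (intro permutes_compose[OF u] permutes_perm_prod_s mem)
  note IH = Cons.IH[OF mem(2,3), folded v_def]
  note step = potential_s[OF v mem(1) asc[folded v_def], of c]
  have eq: "perm_prod s (j # w) \<circ> u = s j \<circ> v" by (simp add: v_def Fun.comp_assoc)
  have "(s j \<circ> v) c = u c \<and> (\<forall>i \<in> set (j # w). u c \<notin> {i, i + 1})"
    if "potential n c u = potential n c (s j \<circ> v)"
  proof -
    have "potential n c u = potential n c v" "v c \<notin> {j, j + 1}"
      using that IH step by (auto simp del: insert_iff)
    with IH show ?thesis by (auto simp: s_apply)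
  qed
  then have "potential n c u \<le> potential n c (s j \<circ> v) \<and>
      (potential n c u = potential n c (s j \<circ> v) \<longrightarrow>
        (s j \<circ> v) c = u c \<and> (\<forall>i \<in> set (j # w). u c \<notin> {i, i + 1}))"
    using order_trans[OF conjunct1[OF IH] step(1)] by blast
  then show ?case unfolding eq .
qed simp

section \<open>Tilings and commutation classes\<close>

primrec tiles :: "nat \<Rightarrow> nat list \<Rightarrow> complex set set" where
  "tiles n [] = {}"
| "tiles n (i # v) = step_tiles n (perm_prod (t n) v) i \<union> tiles n v"

lemma tilesE:
  assumes "Z \<in> tiles n w"
  obtains \<alpha> i \<beta> where "w = \<alpha> @ i # \<beta>" "Z \<in> step_tiles n (perm_prod (t n) \<beta>) i"
proof -
  have "\<exists>\<alpha> i \<beta>. w = \<alpha> @ i # \<beta> \<and> Z \<in> step_tiles n (perm_prod (t n) \<beta>) i"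
    using assms
  proof (induction w)
    case (Cons i w)
    then consider "Z \<in> step_tiles n (perm_prod (t n) w) i" | "Z \<in> tiles n w" by auto
    then show ?case
    proof cases
      case 1
      then show ?thesis by (intro exI[of _ "[]"]) simp
    next
      case 2
      with Cons.IH obtain \<alpha> j \<beta>
        where "w = \<alpha> @ j # \<beta>" "Z \<in> step_tiles n (perm_prod (t n) \<beta>) j" by blast
      then show ?thesis by (intro exI[of _ "i # \<alpha>"]) auto
    qed
  qed simp
  then show thesis using that by blast
qed

lemma ascending_blocks_append:
  "ascending_blocks n (\<alpha> @ \<beta>) \<longleftrightarrow>
    ascending_blocks n \<beta> \<and> ascending (perm_prod (t n) \<beta>) (block_word n \<alpha>)"
  by (simp only: ascending_blocks_def block_word_simps ascending_append perm_prod_block_word comp_id)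

lemma potential_blocks:
  assumes lists: "\<alpha> \<in> lists {1..n}" "\<beta> \<in> lists {1..n}" and asc: "ascending_blocks n (\<alpha> @ \<beta>)"
  shows "potential n c (perm_prod (t n) \<beta>) \<le> potential n c (perm_prod (t n) (\<alpha> @ \<beta>))"
    and "potential n c (perm_prod (t n) \<beta>) = potential n c (perm_prod (t n) (\<alpha> @ \<beta>)) \<Longrightarrow>
      perm_prod (t n) (\<alpha> @ \<beta>) c = perm_prod (t n) \<beta> c \<and>
      (\<forall>i \<in> set \<alpha>. \<forall>(j, k) \<in> intervals n i. perm_prod (t n) \<beta> c \<notin> {j..k})"
proof -
  let ?u = "perm_prod (t n) \<beta>"
  note perm = symmetric_permsD(1)[OF perm_prod_t_symmetric[OF lists(2)]]
  note pot = potential_ascending[OF perm block_word_in_lists[OF lists(1)], of c,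
      unfolded perm_prod_block_word perm_prod_append[symmetric]]
  have *: "ascending ?u (block_word n \<alpha>)" using asc by (simp add: ascending_blocks_append)
  show "potential n c ?u \<le> potential n c (perm_prod (t n) (\<alpha> @ \<beta>))"
    using pot[OF *] by blast
  assume "potential n c ?u = potential n c (perm_prod (t n) (\<alpha> @ \<beta>))"
  then have pos: "perm_prod (t n) (\<alpha> @ \<beta>) c = ?u c"
    "\<And>r. r \<in> set (block_word n \<alpha>) \<Longrightarrow> ?u c \<notin> {r, r + 1}"
    using pot[OF *] by blast+
  \<comment> \<open>The letters of a block touch every position in its ranges, so a block that
    leaves c alone has its ranges away from c.\<close>
  have "?u c \<notin> {j..k}" if a: "i \<in> set \<alpha>" and jk: "(j, k) \<in> intervals n i" for i j k
  proof
    assume "?u c \<in> {j..k}"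
    moreover have "i \<in> {1..n}" using a lists by auto
    ultimately obtain r where "r \<in> set (block n i)" "?u c \<in> {r, r + 1}"
      using interval_facts(5)[OF _ jk] by blast
    moreover from this have "r \<in> set (block_word n \<alpha>)" using a by (auto simp: block_word_def)
    ultimately show False using pos(2) by blast
  qed
  with pos(1) show "perm_prod (t n) (\<alpha> @ \<beta>) c = ?u c \<and>
      (\<forall>i \<in> set \<alpha>. \<forall>(j, k) \<in> intervals n i. ?u c \<notin> {j..k})" by blast
qed

lemma step_tile_facts:
  assumes i: "i \<in> {1..n}" and v: "v \<in> lists {1..n}" and asc: "ascending_blocks n (i # v)"
    and jk: "(j, k) \<in> intervals n i"
  shows "labels n (tile n (perm_prod (t n) v) (j, k)) = {c. perm_prod (t n) (i # v) c \<in> {j..k}}"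
    and "perm_prod (t n) (i # v) c \<in> {j..k} \<Longrightarrow>
      key n c (tile n (perm_prod (t n) v) (j, k)) = potential n c (perm_prod (t n) (i # v))"
proof -
  note sym = perm_prod_t_symmetric[OF v]
  have asc': "inv' (perm_prod (t n) v) (n + i) < inv' (perm_prod (t n) v) (n + i + 1)"
    using asc ascending_block_word_Cons[OF i v] by blast
  show "labels n (tile n (perm_prod (t n) v) (j, k)) = {c. perm_prod (t n) (i # v) c \<in> {j..k}}"
    unfolding perm_prod_simps by (rule labels_tile[OF sym i jk])
  show "key n c (tile n (perm_prod (t n) v) (j, k)) = potential n c (perm_prod (t n) (i # v))"
    if "perm_prod (t n) (i # v) c \<in> {j..k}"
    using that unfolding perm_prod_simps by (rule key_tile[OF sym i asc' jk])
qed

lemma same_tile_imp_same_position: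
  assumes v: "i # v \<in> lists {1..n}" and w: "\<alpha> @ m # \<beta> \<in> lists {1..n}"
    and asc: "ascending_blocks n (i # v)" "ascending_blocks n (\<alpha> @ m # \<beta>)"
    and intervals: "(j, k) \<in> intervals n i" "(j', k') \<in> intervals n m"
    and same: "tile n (perm_prod (t n) v) (j, k) = tile n (perm_prod (t n) \<beta>) (j', k')"
    and prod: "perm_prod (t n) (i # v) = perm_prod (t n) (\<alpha> @ m # \<beta>)"
  shows "j' = j \<and> k' = k \<and> (\<forall>a \<in> set \<alpha>. \<forall>(p, q) \<in> intervals n a. {p..q} \<inter> {j..k} = {})"
proof -
  let ?x = "perm_prod (t n) (i # v)" and ?y = "perm_prod (t n) (m # \<beta>)"
  have mem: "i \<in> {1..n}" "v \<in> lists {1..n}" "\<alpha> \<in> lists {1..n}" "m \<in> {1..n}" "\<beta> \<in> lists {1..n}"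
    "m # \<beta> \<in> lists {1..n}"
    using v w by auto
  have asc': "ascending_blocks n (m # \<beta>)" using asc(2) by (simp only: ascending_blocks_append)
  note facts = step_tile_facts[OF mem(1,2) asc(1) intervals(1)]
    step_tile_facts[OF mem(4,5) asc' intervals(2)]
  have "{c. ?x c \<in> {j..k}} = {c. ?y c \<in> {j'..k'}}"
    unfolding facts(1)[symmetric] same facts(3) by (rule refl)
  then have labels: "?x c \<in> {j..k} \<longleftrightarrow> ?y c \<in> {j'..k'}" for c
    by (simp only: set_eq_iff mem_Collect_eq)
  have touch: "?x c = ?y c \<and> (\<forall>a \<in> set \<alpha>. \<forall>(p, q) \<in> intervals n a. ?y c \<notin> {p..q})"
    if "?x c \<in> {j..k}" for c
  proof -
    \<comment> \<open>Both sides are the key at c of the same point set: read just after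
      \<open>m\<close> in one word, and at the end of the other.\<close>
    have "potential n c ?y = potential n c (perm_prod (t n) (\<alpha> @ m # \<beta>))"
      using facts(2)[OF that] facts(4) that same labels prod by simp
    from potential_blocks(2)[OF mem(3,6) asc(2) this] show ?thesis unfolding prod .
  qed
  have surj: "\<exists>c. perm_prod (t n) u c = l" if "u \<in> lists {1..n}" for u l
    using bij_is_surj[OF symmetric_permsD(2)[OF perm_prod_t_symmetric[OF that]]]
    unfolding surj_def by metis
  \<comment> \<open>Each label of the tile stands at the same position on both paths, so the two
    ranges have the same elements.\<close>
  have "l \<in> {j..k} \<longleftrightarrow> l \<in> {j'..k'}" for l
  proof
    assume l: "l \<in> {j..k}"
    obtain c where c: "?x c = l" using surj[OF v] by blast
    with l have "?y c = l" "?y c \<in> {j'..k'}" using touch[of c] labels[of c] by simp_all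
    then show "l \<in> {j'..k'}" by (simp only:)
  next
    assume l: "l \<in> {j'..k'}"
    obtain c where c: "?y c = l" using surj[OF mem(6)] by blast
    with l have "?x c \<in> {j..k}" using labels[of c] by (simp only:)
    moreover from this have "?x c = l" using touch[of c] c by (simp only:)
    ultimately show "l \<in> {j..k}" by (simp only:)
  qed
  then have "{j..k} = {j'..k'}" by blast
  moreover have "j < k" using interval_facts(2)[OF mem(1) intervals(1)] .
  ultimately have "j' = j \<and> k' = k" unfolding Icc_eq_Icc by linarith
  moreover have "l \<notin> {p..q}" if a: "a \<in> set \<alpha>" "(p, q) \<in> intervals n a" and l: "l \<in> {j..k}"
    for a p q l
  proof -
    obtain c where c: "?x c = l" using surj[OF v] by blast
    with l have "?x c \<in> {j..k}" by simp
    from touch[OF this] have "?y c \<notin> {p..q}" "?y c = ?x c" using a by auto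
    with c show ?thesis by simp
  qed
  ultimately show ?thesis by blast
qed

text \<open>If such a tile recurred, comparing \<open>i # v\<close> with itself would put
  \<open>i\<close> among the letters to the left of the recurrence, and its range would be disjoint
  from itself.\<close>

lemma step_tiles_new:
  assumes v: "i # v \<in> lists {1..n}" and asc: "ascending_blocks n (i # v)"
  shows "step_tiles n (perm_prod (t n) v) i \<inter> tiles n v = {}"
proof (rule ccontr)
  assume "\<not> ?thesis"
  then obtain j k where jk: "(j, k) \<in> intervals n i"
    and Z: "tile n (perm_prod (t n) v) (j, k) \<in> tiles n v"
    by (auto simp: step_tiles_def)
  from tilesE[OF Z] obtain \<alpha> m \<beta> where v_eq: "v = \<alpha> @ m # \<beta>"
    and m: "tile n (perm_prod (t n) v) (j, k) \<in> step_tiles n (perm_prod (t n) \<beta>) m" by blast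
  from m obtain j' k' where jk': "(j', k') \<in> intervals n m"
    "tile n (perm_prod (t n) v) (j, k) = tile n (perm_prod (t n) \<beta>) (j', k')"
    by (auto simp: step_tiles_def)
  have "(i # \<alpha>) @ m # \<beta> = i # v" by (simp add: v_eq)
  from same_tile_imp_same_position[of i v n "i # \<alpha>" m \<beta>, unfolded this, OF v v asc asc jk jk' refl]
  have "{j..k} \<inter> {j..k} = {}" using jk by fastforce
  moreover have "j < k" using v by (intro interval_facts(2)[OF _ jk]) auto
  ultimately show False by simp
qed


subsection \<open>Commutation moves\<close>

lemma replacement_Cons: "(v, w) \<in> (replacement R)\<^sup>* \<Longrightarrow> (a # v, a # w) \<in> (replacement R)\<^sup>*"
proof (induction rule: rtrancl_induct)
  case (step w w')
  from step.hyps(2) obtain p q i j m where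
    "w = p @ alternating m i j @ q" "w' = p @ alternating m j i @ q" "(i, j, m) \<in> R \<or> (j, i, m) \<in> R"
    unfolding replacement_def by blast
  then have "(a # w, a # w') \<in> replacement R"
    unfolding replacement_def
    by (intro CollectI exI[of _ "a # p"] exI[of _ q] exI[of _ i] exI[of _ j] exI[of _ m]) simp
  with step.IH show ?case by simp
qed simp

lemma sym_replacement: "sym (replacement R)"
  unfolding replacement_def by (rule symI) blast

lemma replacement_K_iff:
  "(v, w) \<in> replacement (K n) \<longleftrightarrow> (\<exists>p q i j. v = p @ i # j # q \<and> w = p @ j # i # q \<and>
    i \<in> {1..n} \<and> j \<in> {1..n} \<and> \<bar>int i - int j\<bar> \<ge> 2)"
proof
  assume "(v, w) \<in> replacement (K n)"
  then obtain p q i j m where "v = p @ alternating m i j @ q" "w = p @ alternating m j i @ q"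
    and K: "(i, j, m) \<in> K n \<or> (j, i, m) \<in> K n"
    unfolding replacement_def by blast
  moreover from K have "m = 2" "i \<in> {1..n}" "j \<in> {1..n}" "\<bar>int i - int j\<bar> \<ge> 2"
    by (auto simp: K_def)
  ultimately show "\<exists>p q i j. v = p @ i # j # q \<and> w = p @ j # i # q \<and>
      i \<in> {1..n} \<and> j \<in> {1..n} \<and> \<bar>int i - int j\<bar> \<ge> 2"
    by (intro exI[of _ p] exI[of _ q] exI[of _ i] exI[of _ j]) (simp add: numeral_2_eq_2)
next
  assume "\<exists>p q i j. v = p @ i # j # q \<and> w = p @ j # i # q \<and>
      i \<in> {1..n} \<and> j \<in> {1..n} \<and> \<bar>int i - int j\<bar> \<ge> 2"
  then obtain p q i j where "v = p @ i # j # q" "w = p @ j # i # q" "(i, j, 2) \<in> K n"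
    unfolding K_def by blast
  then show "(v, w) \<in> replacement (K n)"
    unfolding replacement_def
    by (intro CollectI exI[of _ p] exI[of _ q] exI[of _ i] exI[of _ j] exI[of _ "2 :: nat"])
       (simp add: numeral_2_eq_2)
qed

lemma move_to_front:
  assumes "i \<in> {1..n}" "\<alpha> \<in> lists {1..n}" "\<forall>a \<in> set \<alpha>. \<bar>int a - int i\<bar> \<ge> 2"
  shows "(\<alpha> @ i # \<beta>, i # \<alpha> @ \<beta>) \<in> (replacement (K n))\<^sup>*"
  using assms(2,3)
proof (induction \<alpha> rule: list.induct)
  case (Cons a \<alpha>)
  then have "(\<alpha> @ i # \<beta>, i # \<alpha> @ \<beta>) \<in> (replacement (K n))\<^sup>*" by auto
  from replacement_Cons[OF this, of a]
  have "((a # \<alpha>) @ i # \<beta>, a # i # \<alpha> @ \<beta>) \<in> (replacement (K n))\<^sup>*" by simp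
  also have "(a # i # \<alpha> @ \<beta>, i # (a # \<alpha>) @ \<beta>) \<in> replacement (K n)"
    unfolding replacement_K_iff using Cons.prems assms(1)
    by (intro exI[of _ "[]"] exI[of _ "\<alpha> @ \<beta>"] exI[of _ a] exI[of _ i]) auto
  finally show ?case .
qed simp

lemma distant_intervals:
  assumes i: "i \<in> {1..n}" and j: "j \<in> {1..n}" and dist: "\<bar>int i - int j\<bar> \<ge> 2"
    and pq: "(p, q) \<in> intervals n i"
  shows "p - 1 \<notin> set (block n j)" "r \<in> {p..q} \<Longrightarrow> t n j r = r"
proof -
  show "p - 1 \<notin> set (block n j)"
    using assms by (auto simp: intervals_def block_def split: if_splits)
  assume r: "r \<in> {p..q}"
  show "t n j r = r"
  proof (cases "j = 1")
    case True
    then have "r \<noteq> n" "r \<noteq> n + 2"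
      using assms r by (auto simp: intervals_def split: if_splits)
    then show ?thesis unfolding True t_one_apply by simp
  next
    case False
    then have "r \<noteq> n + 1 - j" "r \<noteq> n + 2 - j" "r \<noteq> n + j" "r \<noteq> n + j + 1"
      using assms r by (auto simp: intervals_def split: if_splits)
    with False show ?thesis unfolding t_apply[OF j] by simp
  qed
qed

lemma t_commute:
  assumes i: "i \<in> {1..n}" and j: "j \<in> {1..n}" and dist: "\<bar>int i - int j\<bar> \<ge> 2"
  shows "t n i \<circ> t n j = t n j \<circ> t n i"
proof
  fix r
  have moved: "\<exists>(p, q) \<in> intervals n i. r \<in> {p..q}" if "i \<in> {1..n}" "t n i r \<noteq> r" for i r
    using that(2) unfolding t_apply[OF that(1)] by (auto simp: intervals_def split: if_splits)
  \<comment> \<open>Disjoint supports, each mapped to itself, make the two permutations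
    commute.\<close>
  have fixed: "t n i r = r \<or> t n j r = r" for r
    using moved[OF i, of r] distant_intervals(2)[OF i j dist] by blast
  have stable: "t n i r \<noteq> r \<longleftrightarrow> t n i (t n i r) \<noteq> t n i r" if "i \<in> {1..n}" for i r
    using t_invol(1)[OF that] by metis
  show "(t n i \<circ> t n j) r = (t n j \<circ> t n i) r"
    using fixed[of r] fixed[of "t n i r"] fixed[of "t n j r"] stable[OF i, of r] stable[OF j, of r]
    by auto
qed

lemma step_tiles_distant:
  assumes u: "bij u" and i: "i \<in> {1..n}" and j: "j \<in> {1..n}" and dist: "\<bar>int i - int j\<bar> \<ge> 2"
  shows "step_tiles n (t n j \<circ> u) i = step_tiles n u i"
  unfolding step_tiles_def
proof (rule image_cong[OF refl])
  fix pq assume pq: "pq \<in> intervals n i"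
  obtain p q where pq_eq: "pq = (p, q)" by (cases pq)
  note distant = distant_intervals[OF i j dist pq[unfolded pq_eq]]
  have "inv' (t n j \<circ> u) ` {p..q} = inv' u ` {p..q}"
    using distant(2) by (intro image_cong) (simp_all only: inv_t_comp[OF u j])
  then show "tile n (t n j \<circ> u) pq = tile n u pq"
    by (simp only: pq_eq tile_def case_prod_conv B_t_other[OF u j distant(1)])
qed

lemma replacement_preserves:
  assumes v: "v \<in> reduced_words (X n) (t n) {1..n} x" and vw: "(v, w) \<in> replacement (K n)"
  shows "w \<in> reduced_words (X n) (t n) {1..n} x" "tiles n w = tiles n v"
proof -
  from vw obtain p q i j where eq: "v = p @ i # j # q" "w = p @ j # i # q"
    and ij: "i \<in> {1..n}" "j \<in> {1..n}" and dist: "\<bar>int i - int j\<bar> \<ge> 2"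
    unfolding replacement_K_iff by blast
  have q: "q \<in> lists {1..n}" using v by (auto simp: eq reduced_words_def)
  have prod: "perm_prod (t n) (i # j # q) = perm_prod (t n) (j # i # q)"
    using t_commute[OF ij dist] by (simp add: o_assoc)
  then have "perm_prod (t n) w = perm_prod (t n) v" by (simp only: eq perm_prod_append)
  moreover have "w \<in> lists {1..n} \<longleftrightarrow> v \<in> lists {1..n}" "length w = length v"
    by (auto simp: eq)
  ultimately show "w \<in> reduced_words (X n) (t n) {1..n} x"
    using v unfolding reduced_words_def mem_Collect_eq word_prod_X by metis
  note bij = symmetric_permsD(2)[OF perm_prod_t_symmetric[OF q]]
  have dist': "\<bar>int j - int i\<bar> \<ge> 2" using dist by simp
  have "tiles n (j # i # q) = tiles n (i # j # q)"
    unfolding tiles.simps perm_prod_simps step_tiles_distant[OF bij ij(1,2) dist]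
      step_tiles_distant[OF bij ij(2,1) dist'] by blast
  then show "tiles n w = tiles n v"
    unfolding eq by (induction p) (simp_all only: append.simps tiles.simps perm_prod_append prod)
qed

lemma replacements_preserve:
  assumes "(v, w) \<in> (replacement (K n))\<^sup>*" "v \<in> reduced_words (X n) (t n) {1..n} x"
  shows "w \<in> reduced_words (X n) (t n) {1..n} x \<and> tiles n w = tiles n v"
  using assms(1)
proof (induction rule: rtrancl_induct)
  case (step w w')
  then show ?case using replacement_preserves[of w n x w'] by simp
qed (use assms(2) in simp)

lemma equal_tiles_imp_replacements:
  assumes "v \<in> reduced_words (X n) (t n) {1..n} x" "w \<in> reduced_words (X n) (t n) {1..n} x"
    and "tiles n v = tiles n w"
  shows "(v, w) \<in> (replacement (K n))\<^sup>*"
  using assms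
proof (induction v arbitrary: w x)
  case Nil
  then have "\<forall>v \<in> lists {1..n}. word_prod (X n) (t n) v = x \<longrightarrow> length w \<le> length v"
    "word_prod (X n) (t n) [] = x"
    unfolding reduced_words_def mem_Collect_eq by blast+
  then have "length w \<le> length ([] :: nat list)"
    using lists.Nil by blast
  then show ?case by simp
next
  case (Cons i v)
  from Cons.prems(1) have v: "i # v \<in> lists {1..n}" "perm_prod (t n) (i # v) = x"
    "ascending_blocks n (i # v)"
    unfolding reduced_words_X_iff by auto
  from Cons.prems(2) have w: "w \<in> lists {1..n}" "perm_prod (t n) w = x" "ascending_blocks n w"
    unfolding reduced_words_X_iff by auto
  have i: "i \<in> {1..n}" using v(1) by auto
  \<comment> \<open>Of the tiles of t_i only the one with the largest positions is followed; the
    upper end n + i + 1 of its range identifies i.\<close>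
  define j where "j = (if i = 1 then n else n + i)"
  have jk: "(j, n + i + 1) \<in> intervals n i"
    by (simp add: j_def intervals_def)
  then have "tile n (perm_prod (t n) v) (j, n + i + 1) \<in> tiles n w"
    unfolding Cons.prems(3)[symmetric] by (simp add: step_tiles_def)
  then obtain \<alpha> m \<beta> where w_eq: "w = \<alpha> @ m # \<beta>"
    and m: "tile n (perm_prod (t n) v) (j, n + i + 1) \<in> step_tiles n (perm_prod (t n) \<beta>) m"
    by (rule tilesE)
  from m obtain j' k' where jk': "(j', k') \<in> intervals n m"
    "tile n (perm_prod (t n) v) (j, n + i + 1) = tile n (perm_prod (t n) \<beta>) (j', k')"
    by (auto simp: step_tiles_def)
  have m_range: "m \<in> {1..n}" and \<alpha>: "\<alpha> \<in> lists {1..n}" using w(1) by (auto simp: w_eq)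
  have "perm_prod (t n) (i # v) = perm_prod (t n) (\<alpha> @ m # \<beta>)"
    using v(2) w(2) unfolding w_eq by simp
  from same_tile_imp_same_position[OF v(1) w(1)[unfolded w_eq] v(3) w(3)[unfolded w_eq] jk jk' this]
  have position: "j' = j" "k' = n + i + 1"
    "\<And>a p q. a \<in> set \<alpha> \<Longrightarrow> (p, q) \<in> intervals n a \<Longrightarrow> {p..q} \<inter> {j..n + i + 1} = {}"
    by blast+
  have "m = i"
    using jk'(1) m_range i unfolding position j_def by (auto simp: intervals_def split: if_splits)
  have distant: "\<bar>int a - int i\<bar> \<ge> 2" if a: "a \<in> set \<alpha>" for a
  proof -
    have "(if a = 1 then n else n + a, n + a + 1) \<in> intervals n a"
      by (simp add: intervals_def)
    from position(3)[OF a this]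
    have disjoint: "r \<notin> {(if a = 1 then n else n + a)..n + a + 1} \<or> r \<notin> {j..n + i + 1}" for r
      by blast
    \<comment> \<open>If a and i differed by at most one, the two ranges would share one of these
      positions.\<close>
    from disjoint[of "n + i"] disjoint[of "n + i + 1"] disjoint[of "n + a"] show ?thesis
      by (auto simp: j_def split: if_splits)
  qed
  define v' where "v' = \<alpha> @ \<beta>"
  have moves: "(w, i # v') \<in> (replacement (K n))\<^sup>*"
    unfolding w_eq v'_def \<open>m = i\<close> using i \<alpha> distant by (intro move_to_front) auto
  from replacements_preserve[OF moves Cons.prems(2)]
  have iv': "i # v' \<in> reduced_words (X n) (t n) {1..n} x" "tiles n (i # v') = tiles n w" by auto
  then have v': "i # v' \<in> lists {1..n}" "perm_prod (t n) (i # v') = x"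
    "ascending_blocks n (i # v')"
    unfolding reduced_words_X_iff by auto
  have "t n i \<circ> (t n i \<circ> perm_prod (t n) v') = t n i \<circ> (t n i \<circ> perm_prod (t n) v)"
    using v(2) v'(2) by simp
  then have prod: "perm_prod (t n) v' = perm_prod (t n) v"
    unfolding t_invol(2)[OF i] .
  have lists: "v \<in> lists {1..n}" "v' \<in> lists {1..n}" using v(1) v'(1) by auto
  have "ascending_blocks n v" "ascending_blocks n v'"
    using v(3) v'(3) ascending_block_word_Cons[OF i lists(1)] ascending_block_word_Cons[OF i lists(2)]
    by blast+
  then have reduced: "v \<in> reduced_words (X n) (t n) {1..n} (perm_prod (t n) v)"
    "v' \<in> reduced_words (X n) (t n) {1..n} (perm_prod (t n) v)"
    using lists prod unfolding reduced_words_X_iff by auto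
  \<comment> \<open>Both words begin with \<open>i\<close> acting on the same permutation, so their
    first tiles agree; as these do not recur in the tails, they can be removed from both
    unions.\<close>
  have "tiles n v = tiles n v'"
    using step_tiles_new[OF v(1,3)] step_tiles_new[OF v'(1,3)] iv'(2) Cons.prems(3)
    unfolding tiles.simps prod by blast
  from Cons.IH[OF reduced this] have "(i # v, i # v') \<in> (replacement (K n))\<^sup>*"
    by (rule replacement_Cons)
  also have "(i # v', w) \<in> (replacement (K n))\<^sup>*"
    using moves sym_rtrancl[OF sym_replacement] by (metis symE)
  finally show ?case .
qed


subsection \<open>Tilings of consistent words\<close>

lemma block_in_blocks: "block n i \<in> blocks n i"
  by (simp add: block_def blocks_def)

text \<open>Since any words may be chosen inside the blocks, the megatiling of an ascending word
  depends only on its letters over T.\<close>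

lemma block_lists:
  assumes "list_all2 (\<lambda>b i. b \<in> blocks n i) bs v" "v \<in> lists {1..n}"
  shows "concat bs \<in> lists {1..2 * n}" "perm_prod s (concat bs) = perm_prod (t n) v"
    "length (concat bs) = length (block_word n v)"
    "ascending_blocks n v \<Longrightarrow> megatiling n bs = tiles n v"
  using assms
proof (induction rule: list_all2_induct)
  case (Cons b bs i v)
  {
    case 1
    then show ?case using Cons blocks_perm_prod(2)[of i n b] by auto
  next
    case 2
    then show ?case using Cons blocks_perm_prod(1)[of i n b] by auto
  next
    case 3
    then show ?case using Cons blocks_perm_prod(3)[of i n b] by auto
  next
    case 4
    then have iv: "i \<in> {1..n}" "v \<in> lists {1..n}" and asc_Cons: "ascending_blocks n (i # v)"
      by auto
    note asc = ascending_block_word_Cons[OF iv]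
    have "block_tiles n (perm_prod (t n) v) b = step_tiles n (perm_prod (t n) v) i"
      using asc_Cons asc Cons.hyps(1) by (intro block_tiles_eq[OF perm_prod_t_symmetric[OF iv(2)] iv(1)]) auto
    then show ?case
      using asc_Cons asc Cons.IH(2)[OF iv(2)] Cons.IH(4)[OF _ iv(2)]
      by (simp add: word_prod_W)
  }
qed simp_all

text \<open>Expanding letters into blocks and naming the letter of each block pass between the two
  kinds of words; \<open>reduced_words_W_block_word_iff\<close> matches the two notions of
  reducedness.\<close>

lemma tiles_image: "tiles n ` reduced_words (X n) (t n) {1..n} x = T_X n x"
proof (intro equalityI subsetI)
  fix Y assume "Y \<in> tiles n ` reduced_words (X n) (t n) {1..n} x"
  then obtain v where Y: "Y = tiles n v" and "v \<in> reduced_words (X n) (t n) {1..n} x"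
    by blast
  then have v: "v \<in> lists {1..n}" "perm_prod (t n) v = x" "ascending_blocks n v"
    unfolding reduced_words_X_iff by blast+
  define bs where "bs = map (block n) v"
  have all2: "list_all2 (\<lambda>b i. b \<in> blocks n i) bs v"
    by (simp add: bs_def list_all2_map1 list_all2_same block_in_blocks)
  note facts = block_lists[OF all2 v(1)]
  have "concat bs \<in> reduced_words_W n x"
    using reduced_words_W_block_word_iff[OF facts(1) v(1) facts(2,3)] v(2,3) by simp
  moreover have decomposition: "block_decomposition n (concat bs) bs"
  proof -
    have "i \<in> {1..n} \<and> block n i \<in> reduced_words_W n (t n i)" if "i \<in> set v" for i
      using v(1) that reduced_words_W_t[of i n] block_in_blocks[of n i] by blast
    then show ?thesis unfolding block_decomposition_def bs_def set_map by blast
  qed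
  moreover have "Sigma_consistent n (concat bs)"
    using decomposition unfolding Sigma_consistent_def by blast
  ultimately show "Y \<in> T_X n x"
    unfolding T_X_def using Y facts(4)[OF v(3)] by blast
next
  fix Y assume "Y \<in> T_X n x"
  then obtain bs where Y: "Y = megatiling n bs" and reduced: "concat bs \<in> reduced_words_W n x"
    and "\<forall>b \<in> set bs. \<exists>i \<in> {1..n}. b \<in> reduced_words_W n (t n i)"
    unfolding T_X_def block_decomposition_def by blast
  then obtain f where f: "\<forall>b \<in> set bs. f b \<in> {1..n} \<and> b \<in> blocks n (f b)"
    using reduced_words_W_t by metis
  define v where "v = map f bs"
  have v: "v \<in> lists {1..n}" using f by (auto simp: v_def)
  have "list_all2 (\<lambda>b i. b \<in> blocks n i) bs v"
    using f by (simp add: v_def list_all2_map2 list_all2_same)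
  note facts = block_lists[OF this v]
  have "perm_prod (t n) v = x"
    using reduced facts(2) by (simp add: reduced_words_def word_prod_W)
  moreover from this have asc: "ascending_blocks n v"
    using reduced_words_W_block_word_iff[OF facts(1) v facts(2,3)] reduced by simp
  ultimately have "v \<in> reduced_words (X n) (t n) {1..n} x"
    using v by (simp only: reduced_words_X_iff)
  then show "Y \<in> tiles n ` reduced_words (X n) (t n) {1..n} x"
    using Y facts(4)[OF asc] by blast
qed

lemma bij_betw_quotient_image:
  assumes "E = {(v, w). v \<in> R \<and> w \<in> R \<and> F v = F w}"
  shows "\<exists>f. bij_betw f (R // E) (F ` R)"
proof -
  have classes: "E `` {v} = {w \<in> R. F w = F v}" if "v \<in> R" for v
    using that assms by auto
  \<comment> \<open>The map from values to fibres needs no choice of representatives; its inverse is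
    the bijection sought.\<close>
  have "bij_betw (\<lambda>y. {w \<in> R. F w = y}) (F ` R) (R // E)"
    unfolding bij_betw_def
  proof
    show "inj_on (\<lambda>y. {w \<in> R. F w = y}) (F ` R)"
      by (rule inj_onI) blast
    show "(\<lambda>y. {w \<in> R. F w = y}) ` F ` R = R // E"
      using classes by (auto simp: quotient_def image_iff)
  qed
  then show ?thesis using bij_betw_inv by blast
qed

theorem mainTheorem2:
  fixes n :: nat and x :: "nat \<Rightarrow> nat"
  assumes "n \<ge> 2"
    and "x \<in> carrier (X n)"
  shows "\<exists>f. bij_betw f (R_X_K n x) (T_X n x)"
proof -
  let ?R = "reduced_words (X n) (t n) {1..n} x"
  have "K_equiv (K n) ?R = {(v, w). v \<in> ?R \<and> w \<in> ?R \<and> tiles n v = tiles n w}"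
    unfolding K_equiv_def using replacements_preserve equal_tiles_imp_replacements by blast
  from bij_betw_quotient_image[OF this] show ?thesis
    by (simp only: R_X_K_def reduced_classes_def tiles_image)
qed

end
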